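(* Let $0<q<1$ and $\alpha=\frac{q^{1/2}+q^{-1/2}}{2}$. Let $(P_n)_{n\ge 0}$ be a monic orthogonal polynomial sequence (OPS) satisfying the three-term recurrence relation $$xP_n(x)=P_{n+1}(x)+B_nP_n(x)+C_nP_{n-1}(x),\qquad n=0,1,2,\dots,$$ with $P_{-1}=0$, $B_n\in\mathbb{C}$ and $C_{n+1}\in\mathbb{C}\setminus\{0\}$ for all $n\ge 0$. If $(P_n)_{n\ge 0}$ is classical (with respect to the Askey-Wilson operator $\mathcal{D}_q$), then there exist $\widehat a,\widehat b\in\mathbb{C}$ with $|\widehat a|+|\widehat b|\ne 0$ such that, with $$r_n=\widehat a\,q^n+\widehat b\,q^{-n},\qquad n=0,1,2,\dots,$$ the sequences $(B_n)_{n\ge0}$ and $(C_n)_{n\ge1}$ satisfy $$r_{n+3}B_{n+2}-(r_{n+2}+r_{n+1})B_{n+1}+r_nB_n=0\qquad\text{for all } n\ge 0,$$ and $$r_n\,(B_n-qB_{n-1})(B_n-q^{-1}B_{n-1})=(r_{n+1}+r_{n+2})\left(C_{n+1}-\tfrac14\right)-4\alpha^2r_n\left(C_n-\tfrac14\right)+(r_{n-1}+r_{n-2})\left(C_{n-1}-\tfrac14\right)$$ for all $n\ge 2$.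
   Context: Let $\mathcal{P}$ be the vector space of all polynomials with complex coefficients and $\mathcal{P}^*$ its algebraic dual; $\langle \mathbf{u},f\rangle$ denotes the action of $\mathbf{u}\in\mathcal{P}^*$ on $f\in\mathcal{P}$. A sequence $(P_n)_{n\ge0}$ in $\mathcal{P}$ with $\deg P_n=n$ for each $n$ is called an orthogonal polynomial sequence (OPS) with respect to $\mathbf{u}\in\mathcal{P}^*$ if $\langle \mathbf{u},P_nP_m\rangle=\kappa_n\delta_{n,m}$ for all $n,m\ge0$, with $\kappa_n\in\mathbb{C}\setminus\{0\}$. (No positivity is assumed.) The Askey-Wilson operator $\mathcal{D}_q:\mathcal{P}\to\mathcal{P}$ ($0<q<1$) is defined by $$(\mathcal{D}_qf)(x)=\frac{\breve f(q^{1/2}z)-\breve f(q^{-1/2}z)}{\breve e(q^{1/2}z)-\breve e(q^{-1/2}z)},\qquad x=\tfrac12(z+1/z),$$ where $\breve f(z)=f\big((z+1/z)/2\big)$ and $e(x)=x$. A monic OPS $(P_n)_{n\ge0}$ (with respect to some $\mathbf{u}\in\mathcal{P}^*$) is called classical if the sequence $(\mathcal{D}_qP_{n+1})_{n\ge0}$ is an OPS (with respect to some functional in $\mathcal{P}^*$). *)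

theory Defs
  imports Complex_Main "HOL-Computational_Algebra.Polynomial"
begin

definition dual_space :: "(complex poly \<Rightarrow> complex) set" where
  "dual_space = {u. Vector_Spaces.linear smult (*) u}"

definition ops_wrt :: "(complex poly \<Rightarrow> complex) \<Rightarrow> (nat \<Rightarrow> complex poly) \<Rightarrow> bool" where
  "ops_wrt u P \<longleftrightarrow> (\<forall>n. P n \<noteq> 0 \<and> degree (P n) = n) \<and>
     (\<exists>\<kappa>. (\<forall>n. \<kappa> n \<noteq> 0) \<and> (\<forall>n m. u (P n * P m) = (if n = m then \<kappa> n else 0)))"

definition is_ops :: "(nat \<Rightarrow> complex poly) \<Rightarrow> bool" where
  "is_ops P \<longleftrightarrow> (\<exists>u\<in>dual_space. ops_wrt u P)"

definition monic_ops :: "(nat \<Rightarrow> complex poly) \<Rightarrow> bool" where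
  "monic_ops P \<longleftrightarrow> is_ops P \<and> (\<forall>n. lead_coeff (P n) = 1)"

definition breve :: "complex poly \<Rightarrow> complex \<Rightarrow> complex" where
  "breve f z = poly f ((z + 1 / z) / 2)"

abbreviation qpow :: "real \<Rightarrow> real \<Rightarrow> complex" where
  "qpow q s \<equiv> complex_of_real (q powr s)"

text \<open>
  The quotient defining the Askey--Wilson operator makes sense only for those \<open>z \<noteq> 0\<close> at
  which its denominator does not vanish (that is, \<open>z \<noteq> 1\<close> and \<open>z \<noteq> -1\<close>); the operator returns the
  polynomial that agrees with the quotient at all such \<open>z\<close>. Existence and uniqueness of this
  polynomial are proved in \<open>askey_wilson_ex1\<close> below.
\<close>

definition is_askey_wilson :: "real \<Rightarrow> complex poly \<Rightarrow> complex poly \<Rightarrow> bool" where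
  "is_askey_wilson q f g \<longleftrightarrow>
     (\<forall>z. z \<noteq> 0 \<longrightarrow>
        breve [:0, 1:] (qpow q (1/2) * z) - breve [:0, 1:] (qpow q (-1/2) * z) \<noteq> 0 \<longrightarrow>
        poly g ((z + 1 / z) / 2) =
          (breve f (qpow q (1/2) * z) - breve f (qpow q (-1/2) * z)) /
          (breve [:0, 1:] (qpow q (1/2) * z) - breve [:0, 1:] (qpow q (-1/2) * z)))"

definition askey_wilson :: "real \<Rightarrow> complex poly \<Rightarrow> complex poly" where
  "askey_wilson q f = (THE g. is_askey_wilson q f g)"

definition classical_ops :: "real \<Rightarrow> (nat \<Rightarrow> complex poly) \<Rightarrow> bool" where
  "classical_ops q P \<longleftrightarrow> monic_ops P \<and> is_ops (\<lambda>n. askey_wilson q (P (Suc n)))"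

lemma askey_wilson_denominator:
  assumes "0 < q" "q < 1" "z \<noteq> 0"
  shows "breve [:0, 1:] (qpow q (1/2) * z) - breve [:0, 1:] (qpow q (-1/2) * z)
           = (qpow q (1/2) - qpow q (-1/2)) * (z - 1 / z) / 2"
    and "qpow q (1/2) * qpow q (-1/2) = 1"
    and "qpow q (1/2) - qpow q (-1/2) \<noteq> 0"
proof -
  have "q powr (1/2) * q powr (-1/2) = 1"
    using assms by (simp flip: powr_add)
  then show inv: "qpow q (1/2) * qpow q (-1/2) = 1"
    by (metis of_real_1 of_real_mult)
  have "q powr (1/2) < q powr (-1/2)"
    using assms by (simp add: powr_less_cancel_iff powr_mono_both' powr_less_mono')
  then show "qpow q (1/2) - qpow q (-1/2) \<noteq> 0"
    by (metis eq_iff_diff_eq_0 less_irrefl of_real_eq_iff)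
  define s t where "s = qpow q (1/2)" and "t = qpow q (-1/2)"
  have st: "s * t = 1" "s \<noteq> 0" "t \<noteq> 0" using inv by (auto simp: s_def t_def)
  then have "1 / s = t" "1 / t = s" by (auto simp: field_simps)
  then have "1 / (s * z) = t / z" "1 / (t * z) = s / z"
    by (simp_all flip: divide_divide_eq_left)
  then show "breve [:0, 1:] (qpow q (1/2) * z) - breve [:0, 1:] (qpow q (-1/2) * z)
           = (qpow q (1/2) - qpow q (-1/2)) * (z - 1 / z) / 2"
    unfolding s_def[symmetric] t_def[symmetric] breve_def
    by (simp add: algebra_simps add_divide_distrib diff_divide_distrib)
qed

lemma askey_wilson_ex:
  assumes "0 < q" "q < 1"
  shows "\<exists>g. is_askey_wilson q f g"
proof -
  define s t where "s = qpow q (1/2)" and "t = qpow q (-1/2)"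
  define \<alpha> where "\<alpha> = (s + t) / 2"
  define x y where "x = (\<lambda>z::complex. (z + 1 / z) / 2)" and "y = (\<lambda>z::complex. (z - 1 / z) / 2)"
  have st: "s * t = 1" "s - t \<noteq> 0"
    using askey_wilson_denominator[of q 1] assms by (auto simp: s_def t_def)
  then have st0: "s \<noteq> 0" "t \<noteq> 0" by auto
  have inv: "1 / s = t" "1 / t = s" using st st0 by (auto simp: field_simps)
  have xs: "x (s * z) = \<alpha> * x z + (s - t) / 2 * y z"
    and xt: "x (t * z) = \<alpha> * x z - (s - t) / 2 * y z" for z
  proof -
    have "1 / (s * z) = t / z" "1 / (t * z) = s / z"
      using inv by (simp_all flip: divide_divide_eq_left)
    then have "x (s * z) = (s * z + t / z) / 2" "x (t * z) = (t * z + s / z) / 2"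
      by (simp_all only: x_def)
    then show "x (s * z) = \<alpha> * x z + (s - t) / 2 * y z"
      "x (t * z) = \<alpha> * x z - (s - t) / 2 * y z"
      unfolding \<alpha>_def
      by (simp_all add: x_def[THEN fun_cong, of z] y_def algebra_simps add_divide_distrib diff_divide_distrib)
  qed
  have yx: "y z * y z = x z * x z - 1" if "z \<noteq> 0" for z
    using that by (simp add: x_def y_def field_simps)
  have \<alpha>2: "((s - t) / 2) * ((s - t) / 2) = \<alpha> * \<alpha> - 1"
    using st by (simp add: \<alpha>_def field_simps)
  have "\<exists>g h. \<forall>z. z \<noteq> 0 \<longrightarrow>
          poly f (x (s * z)) = poly h (x z) + (s - t) / 2 * y z * poly g (x z) \<and>
          poly f (x (t * z)) = poly h (x z) - (s - t) / 2 * y z * poly g (x z)"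
  proof (induction f)
    case 0
    show ?case by (rule exI[of _ 0], rule exI[of _ 0]) simp
  next
    case (pCons a f)
    then obtain g h where gh: "\<And>z. z \<noteq> 0 \<Longrightarrow>
          poly f (x (s * z)) = poly h (x z) + (s - t) / 2 * y z * poly g (x z)"
      "\<And>z. z \<noteq> 0 \<Longrightarrow>
          poly f (x (t * z)) = poly h (x z) - (s - t) / 2 * y z * poly g (x z)"
      by blast
    let ?g = "h + smult \<alpha> (pCons 0 g)"
    let ?h = "[:a:] + smult \<alpha> (pCons 0 h) + smult (\<alpha> * \<alpha> - 1) ([:-1, 0, 1:] * g)"
    have "poly (pCons a f) (x (s * z)) = poly ?h (x z) + (s - t) / 2 * y z * poly ?g (x z) \<and>
          poly (pCons a f) (x (t * z)) = poly ?h (x z) - (s - t) / 2 * y z * poly ?g (x z)"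
      if z: "z \<noteq> 0" for z
    proof -
      have e: "(\<alpha> * \<alpha> - 1) * (x z * x z - 1) = ((s - t) / 2 * y z) * ((s - t) / 2 * y z)"
        unfolding \<alpha>2[symmetric] yx[OF z, symmetric] by (simp add: ac_simps)
      have e': "poly ?h (x z) = a + \<alpha> * x z * poly h (x z)
                  + ((s - t) / 2 * y z) * ((s - t) / 2 * y z) * poly g (x z)"
        unfolding e[symmetric] by (simp add: algebra_simps)
      define d where "d = (s - t) / 2 * y z"
      show ?thesis
        unfolding e' poly_pCons gh[OF z] unfolding xs xt
        unfolding d_def[symmetric] by (simp add: algebra_simps)
    qed
    then show ?case by blast
  qed
  then obtain g h where gh: "\<And>z. z \<noteq> 0 \<Longrightarrow>
          poly f (x (s * z)) = poly h (x z) + (s - t) / 2 * y z * poly g (x z)"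
      "\<And>z. z \<noteq> 0 \<Longrightarrow>
          poly f (x (t * z)) = poly h (x z) - (s - t) / 2 * y z * poly g (x z)"
    by blast
  have "is_askey_wilson q f g"
    unfolding is_askey_wilson_def
  proof (intro allI impI)
    fix z :: complex
    assume z: "z \<noteq> 0" and nz: "breve [:0, 1:] (qpow q (1/2) * z) - breve [:0, 1:] (qpow q (-1/2) * z) \<noteq> 0"
    let ?d = "breve [:0, 1:] (qpow q (1/2) * z) - breve [:0, 1:] (qpow q (-1/2) * z)"
    have d: "?d = (s - t) * y z"
      using askey_wilson_denominator(1)[OF assms z] by (simp add: s_def t_def y_def)
    have "breve f (qpow q (1/2) * z) - breve f (qpow q (-1/2) * z) = (s - t) * y z * poly g (x z)"
      using gh[OF z] by (simp add: breve_def s_def t_def x_def)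
    then show "poly g ((z + 1 / z) / 2) =
       (breve f (qpow q (1/2) * z) - breve f (qpow q (-1/2) * z)) / ?d"
      using nz unfolding d by (simp add: x_def)
  qed
  then show ?thesis ..
qed

lemma askey_wilson_ex1:
  assumes "0 < q" "q < 1"
  shows "\<exists>!g. is_askey_wilson q f g"
proof -
  have "g = h" if g: "is_askey_wilson q f g" and h: "is_askey_wilson q f h" for g h
  proof (rule ccontr)
    assume "g \<noteq> h"
    then have fin: "finite {w. poly (g - h) w = 0}"
      by (intro poly_roots_finite) simp
    have "(\<lambda>n. complex_of_nat n) ` {2..} \<subseteq> {w. poly (g - h) w = 0}"
    proof clarify
      fix n :: nat assume n: "n \<ge> 2"
      define z where "z = complex_of_real (real n + sqrt (real n ^ 2 - 1))"
      have "(real n) ^ 2 \<ge> 1" using n by (simp add: one_le_power)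
      then have sq: "sqrt (real n ^ 2 - 1) ^ 2 = real n ^ 2 - 1" by simp
      have pos: "real n + sqrt (real n ^ 2 - 1) > 1"
        using n \<open>(real n) ^ 2 \<ge> 1\<close> by (smt (verit) of_nat_1 of_nat_less_iff numeral_2_eq_2 Suc_le_eq One_nat_def real_sqrt_ge_zero)
      then have z0: "z \<noteq> 0" unfolding z_def by (metis of_real_eq_0_iff not_one_less_zero)
      have "1 / (real n + sqrt (real n ^ 2 - 1)) = real n - sqrt (real n ^ 2 - 1)"
        using pos sq by (simp add: field_simps power2_eq_square)
      then have "1 / z = complex_of_real (real n - sqrt (real n ^ 2 - 1))"
        unfolding z_def by (metis of_real_1 of_real_divide)
      then have x: "(z + 1 / z) / 2 = of_nat n" by (simp add: z_def)
      have "z * z \<noteq> 1"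
      proof -
        have "(real n + sqrt (real n ^ 2 - 1)) * (real n + sqrt (real n ^ 2 - 1)) > 1"
          using pos by (rule less_1_mult[OF _ pos])
        then show ?thesis unfolding z_def by (metis less_irrefl of_real_1 of_real_eq_iff of_real_mult)
      qed
      then have "z - 1 / z \<noteq> 0" using z0 by (simp add: field_simps)
      then have "breve [:0, 1:] (qpow q (1/2) * z) - breve [:0, 1:] (qpow q (-1/2) * z) \<noteq> 0"
        unfolding askey_wilson_denominator(1)[OF assms z0]
        using askey_wilson_denominator(3)[OF assms z0] by simp
      then have "poly g (of_nat n) = poly h (of_nat n)"
        using g h z0 unfolding is_askey_wilson_def x[symmetric] by simp
      then show "poly (g - h) (of_nat n) = 0" by simp
    qed
    then have "finite ((\<lambda>n. complex_of_nat n) ` {2..})" using fin finite_subset by blast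
    then have "finite {2::nat..}" by (rule finite_imageD) (simp add: inj_on_def)
    then show False using infinite_Ici by blast
  qed
  then show ?thesis using askey_wilson_ex[OF assms] by blast
qed

lemma is_askey_wilson_askey_wilson:
  assumes "0 < q" "q < 1"
  shows "is_askey_wilson q f (askey_wilson q f)"
  unfolding askey_wilson_def by (rule theI'[OF askey_wilson_ex1[OF assms]])

end

theory Submission
  imports Defs
begin

text \<open>
  Let \<open>p = q powr (1/2)\<close>, \<open>D\<close> the Askey--Wilson operator, \<open>g n = (p^n - p^(-n)) / (p - 1/p)\<close> and
  \<open>Q n = D (P (n+1)) / g (n+1)\<close>, a monic OPS by hypothesis, with recurrence coefficients \<open>b n\<close>, \<open>c n\<close>.
  The averaging operator is \<open>S f = D (x f) - \<alpha> x D f\<close>, so the recurrence of \<open>P\<close> gives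
  \<open>S P\<^sub>n = D P\<^sub>n\<^sub>+\<^sub>1 + (B\<^sub>n - \<alpha> x) D P\<^sub>n + C\<^sub>n D P\<^sub>n\<^sub>-\<^sub>1\<close>, and \<open>S (x f) = (\<alpha>\<^sup>2 - 1)(x\<^sup>2 - 1) D f + \<alpha> x S f\<close>
  applied to \<open>f = P\<^sub>n\<close> and expanded in the basis \<open>Q\<close> yields four relations between \<open>B, C, b, c\<close>.
  The lowest one is a Riccati equation for \<open>c\<^sub>n\<^sub>-\<^sub>1 / C\<^sub>n\<close>, linearised by
  \<open>c\<^sub>n\<^sub>-\<^sub>1 / C\<^sub>n = g\<^sub>n\<^sub>-\<^sub>1 R\<^sub>n / (g\<^sub>n R\<^sub>n\<^sub>-\<^sub>1)\<close> with \<open>R\<^sub>n = l p^n + m p^(-n)\<close>. Eliminating \<open>b\<close> and \<open>c\<close> by means of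
  \<open>g\<^sub>i R\<^sub>j - g\<^sub>i\<^sub>-\<^sub>1 R\<^sub>j\<^sub>-\<^sub>1 = R\<^sub>i\<^sub>+\<^sub>j\<^sub>-\<^sub>1\<close> gives the two recurrences, with \<open>r\<^sub>n = R\<^sub>2\<^sub>n\<^sub>-\<^sub>1\<close>.
\<close>

subsection \<open>Elimination\<close>

text \<open>With \<open>p^2 = q\<close> this is the symmetric q-number, a Chebyshev value of the
  second kind at \<open>(p + 1 / p) / 2\<close>. Indices are integers because 0 and -1 occur in the
  first relations.\<close>

definition qnum :: "complex \<Rightarrow> int \<Rightarrow> complex" where
  "qnum p n = (p powi n - p powi (- n)) / (p - 1 / p)"

text \<open>The parameters \<open>l\<close> and \<open>m\<close> stay free until the quotients of
  \<open>c\<close> and \<open>C\<close> fix them in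
  \<open>recurrences_from_relations\<close>.\<close>

definition qseq :: "complex \<Rightarrow> complex \<Rightarrow> complex \<Rightarrow> int \<Rightarrow> complex" where
  "qseq l m p n = l * p powi n + m * p powi (- n)"

lemma qnum_eq_qseq: "qnum p = qseq (1 / (p - 1 / p)) (- (1 / (p - 1 / p))) p"
  by (rule ext) (simp add: qnum_def qseq_def diff_divide_distrib)

lemma qseq_rec:
  assumes "p \<noteq> 0"
  shows "qseq l m p (n + 1) = (p + 1 / p) * qseq l m p n - qseq l m p (n - 1)"
proof -
  define X where "X = p powi n"
  have "X \<noteq> 0" using assms by (simp add: X_def)
  then show ?thesis
    using assms unfolding qseq_def
    by (simp add: power_int_add power_int_diff power_int_minus X_def[symmetric] field_simps)
qed

text \<open>With \<open>X = p powi i\<close> and \<open>Y = p powi j\<close>, the mixed terms in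
  \<open>X / Y\<close> and \<open>Y / X\<close> cancel between the two products, leaving only
  \<open>X * Y\<close> and its inverse.\<close>

lemma qnum_qseq:
  assumes "p \<noteq> 0" "p^2 \<noteq> 1"
  shows "qnum p i * qseq l m p j - qnum p (i - 1) * qseq l m p (j - 1) = qseq l m p (i + j - 1)"
proof -
  have k: "p - 1 / p \<noteq> 0" using assms by (simp add: field_simps power2_eq_square)
  define X Y where "X = p powi i" and "Y = p powi j"
  have XY: "X \<noteq> 0" "Y \<noteq> 0" using assms by (simp_all add: X_def Y_def)
  have e: "p powi i = X" "p powi (- i) = 1 / X" "p powi j = Y" "p powi (- j) = 1 / Y"
    "p powi (i - 1) = X / p" "p powi (- (i - 1)) = p / X"
    "p powi (j - 1) = Y / p" "p powi (- (j - 1)) = p / Y"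
    "p powi (i + j - 1) = X * Y / p" "p powi (- (i + j - 1)) = p / (X * Y)"
    using assms by (simp_all add: X_def Y_def power_int_add power_int_diff power_int_minus field_simps)
  have "(X - 1 / X) * (l * Y + m * (1 / Y)) - (X / p - p / X) * (l * (Y / p) + m * (p / Y))
    = (p - 1 / p) * (l * (X * Y / p) + m * (p / (X * Y)))"
    using assms XY by (simp add: field_simps)
  then show ?thesis
    unfolding qnum_def qseq_def e times_divide_eq_left diff_divide_distrib[symmetric]
    using k by (metis nonzero_mult_div_cancel_left)
qed

section \<open>Elimination of \<open>b\<close> and \<open>c\<close> from the coefficient
  relations\<close>

text \<open>\<open>e4\<close> is a Riccati equation for \<open>c k / C (k + 1)\<close>, and
  \<open>R\<close> solves the linear recurrence behind it. \<open>R 2\<close> is chosen to make the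
  case \<open>k = 1\<close> true; the cross-multiplied form also covers \<open>k = 0\<close>, where
  \<open>c 0 = g 0 = 0\<close>.\<close>

lemma coefficient_ratio:
  fixes C c g R :: "nat \<Rightarrow> complex"
  assumes C: "\<And>k. C (Suc k) \<noteq> 0" and c: "\<And>k. c (Suc k) \<noteq> 0" "c 0 = 0"
    and g: "\<And>k. g (Suc k) \<noteq> 0" "g 0 = 0"
    and R: "\<And>k. R (k + 2) = al2 * R (k + 1) - R k" "R 1 = 1" "R 2 = c 1 * g 2 / (C 2 * g 1)"
    and e4: "\<And>k. al2 * g (k + 2) * C (k + 3) * c (k + 1)
        - g (k + 3) * c (k + 2) * c (k + 1) - g (k + 1) * C (k + 3) * C (k + 2) = 0"
  shows "c k * g (k + 1) * R k = C (k + 1) * g k * R (k + 1)"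
proof (cases k)
  case 0
  then show ?thesis using c g by simp
next
  case (Suc j)
  have "c (Suc j) * g (Suc j + 1) * R (Suc j) = C (Suc j + 1) * g (Suc j) * R (Suc j + 1) \<and> R (Suc j) \<noteq> 0" for j
  proof (induction j)
    case 0
    then show ?case using R(2,3) C[of 1] g(1)[of 0] by (simp add: numeral_2_eq_2)
  next
    case (Suc j)
    have nz: "c (j + 1) \<noteq> 0" "g (j + 2) \<noteq> 0" using c(1)[of j] g(1)[of "j + 1"] by simp_all
    have IH: "c (j + 1) * g (j + 2) * R (j + 1) = C (j + 2) * g (j + 1) * R (j + 2)" "R (j + 1) \<noteq> 0"
      using Suc by simp_all
    have R3: "R (j + 3) = al2 * R (j + 2) - R (j + 1)"
      using R(1)[of "j + 1"] by (simp add: numeral_3_eq_3)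
    \<comment> \<open>Multiply \<open>e4\<close> by \<open>R (j + 2)\<close>: the induction
      hypothesis trades the term in \<open>C (j + 2)\<close> for one in \<open>R (j + 1)\<close>,
      and \<open>R3\<close> collects the rest.\<close>
    have "c (j + 1) * (c (j + 2) * g (j + 3) * R (j + 2)) = c (j + 1) * (C (j + 3) * g (j + 2) * R (j + 3))"
      using e4[of j] R3 IH(1) by algebra
    moreover have "R (j + 2) \<noteq> 0"
      using IH nz by auto
    ultimately show ?case using nz by (simp add: numeral_3_eq_3)
  qed
  then show ?thesis using Suc by blast
qed

text \<open>Two consecutive instances of each linear relation suffice to eliminate
  \<open>bm\<close>, \<open>b0\<close> and \<open>bp\<close>. The factor
  \<open>qnum p (n - 1)\<close> in the first \<open>e3\<close> admits \<open>n = 1\<close>, where it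
  is zero.\<close>

lemma B_recurrence_step:
  fixes p :: complex
  assumes p: "p \<noteq> 0" "p^2 \<noteq> 1"
    and e1: "qnum p n * B0 - qnum p (n - 2) * Bm = qnum p (n + 1) * b0 - qnum p (n - 1) * bm"
      "qnum p (n + 1) * Bp - qnum p (n - 1) * B0 = qnum p (n + 2) * bp - qnum p n * b0"
    and e3: "qnum p (n - 1) * (qseq l m p (n + 1) * B0 - qseq l m p (n - 1) * Bm)
        = qnum p (n - 1) * (qseq l m p n * b0 - qseq l m p (n - 2) * bm)"
      "qseq l m p (n + 2) * Bp - qseq l m p n * B0 = qseq l m p (n + 1) * bp - qseq l m p (n - 1) * b0"
  shows "qseq l m p (2 * n + 3) * Bp - (qseq l m p (2 * n + 1) + qseq l m p (2 * n - 1)) * B0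
    + qseq l m p (2 * n - 3) * Bm = 0"
proof -
  let ?g = "qnum p" and ?R = "qseq l m p"
  have i: "?R (2 * n + 3) = ?g (n + 2) * ?R (n + 2) - ?g (n + 1) * ?R (n + 1)"
    "?R (2 * n + 1) = ?g (n + 2) * ?R n - ?g (n + 1) * ?R (n - 1)"
    "?R (2 * n - 1) = ?g (n + 1) * ?R (n - 1) - ?g n * ?R (n - 2)"
    "?R (2 * n - 3) = ?g (n - 1) * ?R (n - 1) - ?g (n - 2) * ?R (n - 2)"
    "?g (n + 2) * ?R (n - 1) - ?g (n + 1) * ?R (n - 2) = ?g (n + 1) * ?R n - ?g n * ?R (n - 1)"
    "?g n * ?R (n + 1) - ?g (n - 1) * ?R n = ?g (n + 1) * ?R n - ?g n * ?R (n - 1)"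
    using qnum_qseq[OF p, of "n + 2" l m "n + 2"] qnum_qseq[OF p, of "n + 2" l m n]
      qnum_qseq[OF p, of "n + 1" l m "n - 1"] qnum_qseq[OF p, of "n - 1" l m "n - 1"]
      qnum_qseq[OF p, of "n + 2" l m "n - 1"] qnum_qseq[OF p, of "n + 1" l m n]
      qnum_qseq[OF p, of n l m "n + 1"]
    by (simp_all add: algebra_simps)
  \<comment> \<open>\<open>?g (n + 2)\<close> times the second \<open>e3\<close> minus
    \<open>?R (n + 1)\<close> times the second \<open>e1\<close> removes \<open>bp\<close>; the
    first \<open>e3\<close> minus \<open>?R (n - 2)\<close> times the first \<open>e1\<close>
    removes \<open>bm\<close>. In the difference of the two results \<open>b0\<close> cancels by
    \<open>i(5,6)\<close>, all of whose sides equal \<open>?R (2 * n)\<close>.\<close>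
  show ?thesis unfolding i(1-4) using e1 e3 i(5,6) by algebra
qed

text \<open>
  In \<open>u = b - p x\<close>, \<open>u' = b - x / p\<close>, \<open>v = c - p y\<close>, \<open>v' = c - y / p\<close> the hypotheses only tie
  \<open>u - v / p\<^sup>2\<close> to \<open>u' - p\<^sup>2 v'\<close> and \<open>u' - v' / p\<^sup>2\<close> to \<open>u - p\<^sup>2 v\<close>, so they are solved by two
  parameters \<open>s, w\<close>; this covers the case where \<open>x, y\<close> cannot be expressed through \<open>b, c\<close>.
\<close>

lemma quadratic_identity:
  fixes p P l m b c x y :: complex
  assumes p: "p \<noteq> 0" "p^4 \<noteq> 1" and P: "P \<noteq> 0" and lm: "l \<noteq> 0 \<or> m \<noteq> 0"
    and e1: "P^2 * (b - p * x - (c - p * y) / p^2) = b - x / p - p^2 * (c - y / p)"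
    and e3: "l * p^2 * P^2 * (b - x / p - (c - y / p) / p^2) + m * (b - p * x - p^2 * (c - p * y)) = 0"
  shows "(p + 1 / p) * ((P * p - 1 / (P * p)) * (l * P + m / P) * ((b - p * x) * (b - x / p))
      - (P / p - p / P) * (l * P / p^2 + m * p^2 / P) * ((c - p * y) * (c - y / p)))
    = (p - 1 / p) * (l * P^2 / p + m * p / P^2) * ((b - p^2 * c) * (b - c / p^2))"
proof -
  define s where "s = b - p * x - (c - p * y) / p^2"
  define u u' v v' where uv: "u = b - p * x" "u' = b - x / p" "v = c - p * y" "v' = c - y / p"
  define a3 where "a3 = u' - v' / p^2"
  define a4 where "a4 = u - p^2 * v"
  have a1: "s = u - v / p^2" by (simp add: s_def uv)
  have a2: "P^2 * s = u' - p^2 * v'" using e1 by (simp add: s_def uv)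
  have e3': "l * p^2 * P^2 * a3 + m * a4 = 0"
    using e3 by (simp add: a3_def a4_def uv)
  \<comment> \<open>By \<open>e3'\<close> the pair \<open>(a3, a4)\<close> annihilates the nonzero
    pair \<open>(l * p^2 * P^2, m)\<close>, so it is a multiple of
    \<open>(- m, l * p^2 * P^2)\<close>.\<close>
  have "\<exists>w. a3 = - m * w \<and> a4 = l * p^2 * P^2 * w"
  proof (cases "l = 0")
    case False
    show ?thesis
      by (rule exI[of _ "a4 / (l * p^2 * P^2)"], use e3' False p P in \<open>simp add: field_simps add_eq_0_iff\<close>)
  next
    case True
    then show ?thesis using lm e3' by (intro exI[of _ "- a3 / m"]) (auto simp: field_simps)
  qed
  then obtain w where w: "a3 = - m * w" "a4 = l * p^2 * P^2 * w" by blast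
  \<comment> \<open>Up to sign and a power of \<open>p\<close>, \<open>K\<close> is the determinant
    of the systems giving \<open>(u, v)\<close> from \<open>(s, a4)\<close> and
    \<open>(u', v')\<close> from \<open>(P^2 * s, a3)\<close>.\<close>
  define K where "K = p^4 - 1"
  have K: "K \<noteq> 0" using p by (simp add: K_def)
  have p1: "p^2 * s = p^2 * u - v" using a1 p by (simp add: field_simps)
  have p3: "p^2 * a3 = p^2 * u' - v'" using p by (simp add: a3_def field_simps)
  have u: "K * u = p^4 * s - l * p^2 * P^2 * w"
    using p1 a4_def w(2) K_def by algebra
  have u': "K * u' = - (p^4 * m * w) - P^2 * s"
    using a2 p3 w(1) K_def by algebra
  have v: "K * v = p^2 * (s - l * p^2 * P^2 * w)"
    using p1 a4_def w(2) K_def by algebra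
  have v': "K * v' = p^2 * (- m * w - P^2 * s)"
    using a2 p3 w(1) K_def by algebra
  have bb: "(p^2 - 1) * b = p^2 * u' - u" and cc: "(p^2 - 1) * c = p^2 * v' - v"
    unfolding uv using p by (simp_all add: field_simps power2_eq_square)
  have "(p^2 - 1) * (b - p^2 * c) = p^2 * (P^2 * s) - a4"
    using bb cc a2 a4_def by algebra
  then have f1: "(p^2 - 1) * (b - p^2 * c) = p^2 * P^2 * (s - l * w)"
    by (simp add: w algebra_simps)
  have "(p^2 - 1) * (b - c / p^2) = p^2 * a3 - s"
    unfolding right_diff_distrib using bb cc p p1 p3
    by (simp add: field_simps) algebra
  then have f2: "(p^2 - 1) * (b - c / p^2) = - (p^2 * m * w + s)"
    by (simp add: w algebra_simps)
  have uu: "K^2 * (u * u') = (p^4 * s - l * p^2 * P^2 * w) * (- (p^4 * m * w) - P^2 * s)"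
    unfolding u[symmetric] u'[symmetric] by algebra
  have vv: "K^2 * (v * v') = p^4 * (s - l * p^2 * P^2 * w) * (- m * w - P^2 * s)"
    using v v' by algebra
  have ff: "(p^2 - 1)^2 * ((b - p^2 * c) * (b - c / p^2)) = - (p^2) * P^2 * (s - l * w) * (p^2 * m * w + s)"
    using f1 f2 by algebra
  let ?L = "(p + 1 / p) * ((P * p - 1 / (P * p)) * (l * P + m / P) * (u * u')
      - (P / p - p / P) * (l * P / p^2 + m * p^2 / P) * (v * v'))"
  let ?R = "(p - 1 / p) * (l * P^2 / p + m * p / P^2) * ((b - p^2 * c) * (b - c / p^2))"
  \<comment> \<open>\<open>F\<close> clears the powers of \<open>p\<close> and \<open>P\<close> in
    both denominators. The further factor \<open>K^2 = (p^2 - 1)^2 * (p^2 + 1)^2\<close> makes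
    \<open>uu\<close>, \<open>vv\<close> and \<open>ff\<close> applicable, so that a polynomial
    identity in \<open>s\<close> and \<open>w\<close> remains.\<close>
  define F where "F = p^4 * P^2"
  have "F * ?L = (p^2+1) * ((P^2 * p^2 - 1) * (l * P^2 + m) * p^2 * (u * u') 
     - (P^2 - p^2) * (l * P^2 + m * p^4) * (v * v'))"
    unfolding F_def using p P
    by (simp add: field_simps power2_eq_square power4_eq_xxxx)
  then have L: "K^2 * F * ?L = (p^2+1) * ((P^2 * p^2 - 1) * (l * P^2 + m) * p^2 * (K^2 * (u * u'))
     - (P^2 - p^2) * (l * P^2 + m * p^4) * (K^2 * (v * v')))"
    by algebra
  have "F * ?R = p^2 * (p^2 - 1) * (l * P^4 + m * p^2) * ((b - p^2 * c) * (b - c / p^2))"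
    unfolding F_def using p P
    by (simp add: field_simps power2_eq_square power4_eq_xxxx)
  then have R: "K^2 * F * ?R = p^2 * (p^2 - 1) * (p^2 + 1)^2 * (l * P^4 + m * p^2) * 
     ((p^2 - 1)^2 * ((b - p^2 * c) * (b - c / p^2)))"
    unfolding K_def by algebra
  have "K^2 * F * ?L = K^2 * F * ?R"
    unfolding L R uu vv ff by algebra
  moreover have "K^2 * F \<noteq> 0" using K p P by (simp add: F_def)
  ultimately have "?L = ?R" using mult_left_cancel by blast
  then show ?thesis unfolding uv .
qed

text \<open>The relations \<open>e2\<close> and \<open>r\<close> eliminate the \<open>c\<close>
  terms and give the part linear in \<open>C\<close>; \<open>quadratic_identity\<close> then removes
  \<open>b0\<close> and \<open>bm\<close> from the remaining quadratic forms.\<close>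

lemma C_recurrence_step:
  fixes p :: complex
  assumes p: "p \<noteq> 0" "p^4 \<noteq> 1" and lm: "l \<noteq> 0 \<or> m \<noteq> 0" and al: "al = (p + 1 / p) / 2"
    and gn: "qnum p n \<noteq> 0"
    and e1: "qnum p n * B0 - qnum p (n - 2) * Bm = qnum p (n + 1) * b0 - qnum p (n - 1) * bm"
    and e3: "qseq l m p (n + 1) * B0 - qseq l m p (n - 1) * Bm
        = qseq l m p n * b0 - qseq l m p (n - 2) * bm"
    and e2: "qnum p (n + 2) * c0 - qnum p n * cm - qnum p n * Cp + qnum p (n - 2) * C0
        = qnum p n * (B0^2 - 2 * al * B0 * b0 + b0^2 + al^2 - 1)"
      "qnum p (n + 1) * cm - qnum p (n - 1) * cmm - qnum p (n - 1) * C0 + qnum p (n - 3) * Cm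
        = qnum p (n - 1) * (Bm^2 - 2 * al * Bm * bm + bm^2 + al^2 - 1)"
    and r: "c0 * qnum p (n + 1) * qseq l m p n = Cp * qnum p n * qseq l m p (n + 1)"
      "cm * qnum p n * qseq l m p (n - 1) = C0 * qnum p (n - 1) * qseq l m p n"
      "cmm * qnum p (n - 1) * qseq l m p (n - 2) = Cm * qnum p (n - 2) * qseq l m p (n - 1)"
  shows "qseq l m p (2 * n - 1) * (B0 - p^2 * Bm) * (B0 - inverse (p^2) * Bm)
    = (qseq l m p (2 * n + 1) + qseq l m p (2 * n + 3)) * (Cp - 1/4)
      - 4 * al^2 * qseq l m p (2 * n - 1) * (C0 - 1/4)
      + (qseq l m p (2 * n - 3) + qseq l m p (2 * n - 5)) * (Cm - 1/4)"
proof -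
  let ?g = "qnum p" and ?R = "qseq l m p"
  have p2: "p^2 \<noteq> 1" using p(2) by (auto simp: power4_eq_xxxx power2_eq_square)
  have al2: "2 * al = p + 1 / p" by (simp add: al)
  have rec: "?R (k + 1) = 2 * al * ?R k - ?R (k - 1)" "?g (k + 1) = 2 * al * ?g k - ?g (k - 1)" for k
    using qseq_rec[OF p(1)] by (simp_all add: al qnum_eq_qseq)
  define q1 q0 where "q1 = B0^2 - 2 * al * B0 * b0 + b0^2" and "q0 = Bm^2 - 2 * al * Bm * bm + bm^2"
  have i: "?R (2 * n + 2) = ?g (n + 2) * ?R (n + 1) - ?g (n + 1) * ?R n"
    "?R (2 * n) = ?g (n + 1) * ?R n - ?g n * ?R (n - 1)"
    "?R (2 * n - 2) = ?g n * ?R (n - 1) - ?g (n - 1) * ?R (n - 2)"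
    "?R (2 * n - 4) = ?g (n - 2) * ?R (n - 1) - ?g (n - 3) * ?R (n - 2)"
    using qnum_qseq[OF p(1) p2, of "n + 2" l m "n + 1"] qnum_qseq[OF p(1) p2, of "n + 1" l m n]
      qnum_qseq[OF p(1) p2, of n l m "n - 1"] qnum_qseq[OF p(1) p2, of "n - 2" l m "n - 1"]
    by (simp_all add: algebra_simps)
  have j: "?R (2 * n) + ?R (2 * n - 2) = 2 * al * ?R (2 * n - 1)"
    "?R (2 * n + 1) + ?R (2 * n + 3) = 2 * al * ?R (2 * n + 2)"
    "?R (2 * n - 3) + ?R (2 * n - 5) = 2 * al * ?R (2 * n - 4)"
    "?R n + ?R (n - 2) = 2 * al * ?R (n - 1)" "?g n + ?g (n - 2) = 2 * al * ?g (n - 1)"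
    using rec(1)[of "2 * n - 1"] rec(1)[of "2 * n + 2"] rec(1)[of "2 * n - 4"] rec(1)[of "n - 1"] rec(2)[of "n - 1"]
    by (simp_all add: algebra_simps)
  \<comment> \<open>\<open>?g (n + 1) * ?R n\<close> times the first \<open>e2\<close> minus
    \<open>?g n * ?R (n - 2)\<close> times the second: the two \<open>cm\<close> terms merge by
    \<open>j(4)\<close>, and \<open>r\<close> replaces each \<open>c\<close> by a
    \<open>C\<close>.\<close>
  have "?g n * (?R (2 * n + 2) * Cp - 2 * al * ?R (2 * n - 1) * C0 + ?R (2 * n - 4) * Cm)
    = ?g n * (?g (n + 1) * ?R n * (q1 + al^2 - 1) - ?g (n - 1) * ?R (n - 2) * (q0 + al^2 - 1))"
    unfolding j(1)[symmetric] i q1_def q0_def using e2 r j(4,5) by algebra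
  then have lin: "?R (2 * n + 2) * Cp - 2 * al * ?R (2 * n - 1) * C0 + ?R (2 * n - 4) * Cm
    = ?g (n + 1) * ?R n * (q1 + al^2 - 1) - ?g (n - 1) * ?R (n - 2) * (q0 + al^2 - 1)"
    using gn by simp
  \<comment> \<open>The factor is twice the Chebyshev polynomial \<open>T_3(al)\<close>. This
    relation absorbs the constant \<open>al^2 - 1\<close> into the shifts of \<open>C\<close> by
    \<open>1/4\<close>.\<close>
  have const: "?R (2 * n + 2) + ?R (2 * n - 4) = (8 * al^3 - 6 * al) * ?R (2 * n - 1)"
    using rec(1)[of "2 * n + 1"] rec(1)[of "2 * n"] rec(1)[of "2 * n - 1"] rec(1)[of "2 * n - 2"]
      rec(1)[of "2 * n - 3"] by (simp add: algebra_simps) algebra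
  have quad: "2 * al * (?g (n + 1) * ?R n * q1 - ?g (n - 1) * ?R (n - 2) * q0)
    = ?R (2 * n - 1) * ((B0 - p^2 * Bm) * (B0 - Bm / p^2))"
  proof -
    define P where "P = p powi n"
    have P: "P \<noteq> 0" using p by (simp add: P_def)
    define k where "k = p - 1 / p"
    have k: "k \<noteq> 0" using p(1) p2 by (simp add: k_def field_simps power2_eq_square)
    have R: "?R n = l * P + m / P" "?R (n - 2) = l * P / p^2 + m * p^2 / P"
      "?R (n + 1) = l * P * p + m / (P * p)" "?R (n - 1) = l * P / p + m * p / P"
      "?R (2 * n - 1) = l * P^2 / p + m * p / P^2"
      using p(1) by (simp_all add: qseq_def P_def power_int_add power_int_diff power_int_minus
          field_simps power2_eq_square power_int_mult)
    have g: "k * ?g n = P - 1 / P" "k * ?g (n - 2) = P / p^2 - p^2 / P"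
      "k * ?g (n + 1) = P * p - 1 / (P * p)" "k * ?g (n - 1) = P / p - p / P"
      using p(1) k by (simp_all add: qnum_def k_def[symmetric] P_def power_int_add power_int_diff
          power_int_minus field_simps power2_eq_square)
    have e1': "k * ?g n * B0 - k * ?g (n - 2) * Bm = k * ?g (n + 1) * b0 - k * ?g (n - 1) * bm"
      using e1 by algebra
    \<comment> \<open>The hypotheses of \<open>quadratic_identity\<close> are \<open>e1\<close>
      times \<open>k * P\<close> and \<open>e3\<close> times \<open>P * p\<close>.\<close>
    have "P^2 * (B0 - p * b0 - (Bm - p * bm) / p^2) - (B0 - b0 / p - p^2 * (Bm - bm / p))
      = P * ((P - 1 / P) * B0 - (P / p^2 - p^2 / P) * Bm
        - (P * p - 1 / (P * p)) * b0 + (P / p - p / P) * bm)"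
      using P p(1) by (simp add: field_simps power2_eq_square)
    also have "\<dots> = 0"
      using e1' unfolding g by simp
    finally have 1: "P^2 * (B0 - p * b0 - (Bm - p * bm) / p^2) = B0 - b0 / p - p^2 * (Bm - bm / p)"
      by simp
    have "l * p^2 * P^2 * (B0 - b0 / p - (Bm - bm / p) / p^2) + m * (B0 - p * b0 - p^2 * (Bm - p * bm))
      = P * p * ((l * P * p + m / (P * p)) * B0 - (l * P / p + m * p / P) * Bm
       - (l * P + m / P) * b0 + (l * P / p^2 + m * p^2 / P) * bm)"
      using P p(1) by (simp add: field_simps power2_eq_square)
    also have "\<dots> = 0"
      using e3 unfolding R by simp
    finally have 2: "l * p^2 * P^2 * (B0 - b0 / p - (Bm - bm / p) / p^2) + m * (B0 - p * b0 - p^2 * (Bm - p * bm)) = 0" .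
    \<comment> \<open>The quadratic forms split because \<open>2 * al\<close> is the sum of the
      mutually inverse numbers \<open>p\<close> and \<open>1 / p\<close>.\<close>
    have q: "q1 = (B0 - p * b0) * (B0 - b0 / p)" "q0 = (Bm - p * bm) * (Bm - bm / p)"
      using p(1) by (simp_all add: q1_def q0_def al field_simps power2_eq_square)
    have "k * (2 * al * (?g (n + 1) * ?R n * q1 - ?g (n - 1) * ?R (n - 2) * q0))
      = (p + 1 / p) * ((k * ?g (n + 1)) * ?R n * q1 - (k * ?g (n - 1)) * ?R (n - 2) * q0)"
      unfolding al2[symmetric] by algebra
    also have "\<dots> = k * (?R (2 * n - 1) * ((B0 - p^2 * Bm) * (B0 - Bm / p^2)))"
      unfolding g R q unfolding k_def using quadratic_identity[OF p P lm 1 2] by (simp add: mult.assoc)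
    finally show ?thesis using k by simp
  qed
  have "?R (2 * n - 1) * (B0 - p^2 * Bm) * (B0 - inverse (p^2) * Bm)
    = ?R (2 * n - 1) * ((B0 - p^2 * Bm) * (B0 - Bm / p^2))"
    by (simp add: divide_inverse mult_ac)
  also have "\<dots> = 2 * al * (?R (2 * n + 2) * Cp - 2 * al * ?R (2 * n - 1) * C0 + ?R (2 * n - 4) * Cm
     - (al^2 - 1) * (2 * al * ?R (2 * n - 1)))"
    unfolding quad[symmetric] using lin j(1) i(2,3) by algebra
  also have "\<dots> = 2 * al * (?R (2 * n + 2) * (Cp - 1/4) - 2 * al * ?R (2 * n - 1) * (C0 - 1/4) + ?R (2 * n - 4) * (Cm - 1/4))"
    using const by algebra
  finally show ?thesis unfolding j by (simp add: algebra_simps power2_eq_square)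
qed

lemma qseq_fit:
  assumes "p \<noteq> 0" "p^2 \<noteq> 1"
  obtains l m where "qseq l m p 1 = 1" "qseq l m p 2 = x"
proof
  define K where "K = p^2 - 1"
  have K: "K \<noteq> 0" using assms by (simp add: K_def)
  \<comment> \<open>Cramer's rule for the values at 1 and 2; the determinant is
    \<open>1 / p - p\<close>.\<close>
  let ?l = "(x * p^2 - p) / (p^2 * K)" and ?m = "p^2 * (p - x) / K"
  have n: "p powi - 2 = 1 / p^2" "p powi - 1 = 1 / p" using assms by (simp_all add: power_int_minus field_simps)
  have "qseq ?l ?m p 1 = (x * p - 1 + p * (p - x)) / K"
    unfolding qseq_def n using assms K by (simp add: field_simps power2_eq_square)
  also have "x * p - 1 + p * (p - x) = K" by (simp add: K_def algebra_simps power2_eq_square)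
  finally show "qseq ?l ?m p 1 = 1" using K by simp
  have "qseq ?l ?m p 2 = (x * p^2 - p + (p - x)) / K"
    unfolding qseq_def n using assms K by (simp add: field_simps power2_eq_square)
  also have "x * p^2 - p + (p - x) = x * K" by (simp add: K_def algebra_simps)
  finally show "qseq ?l ?m p 2 = x" using K by simp
qed

text \<open>\<open>e0\<close> is the instance \<open>k = -1\<close> of \<open>e1\<close>, in which
  the term with \<open>b (-1)\<close> carries the factor \<open>g 0 = 0\<close>. The indices in the
  conclusion are those of \<open>r n = qseq l m p (2 * n - 1)\<close>.\<close>

lemma recurrences_from_relations:
  fixes B C b c :: "nat \<Rightarrow> complex" and p al :: complex
  defines "g \<equiv> qnum p"
  assumes p: "p \<noteq> 0" "p^4 \<noteq> 1" and al: "al = (p + 1 / p) / 2"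
    and gnz: "\<And>k. g (int k + 1) \<noteq> 0"
    and C: "\<And>k. C (Suc k) \<noteq> 0" and c: "\<And>k. c (Suc k) \<noteq> 0" "c 0 = 0"
    and e0: "2 * al * b 0 = B 0 + B 1"
    and e1: "\<And>k. g (int k + 3) * b (k + 1) - g (int k + 1) * b k - g (int k + 2) * B (k + 2) + g (int k) * B (k + 1) = 0"
    and e2: "\<And>k. g (int k + 3) * c (k + 1) - g (int k + 1) * c k - g (int k + 1) * C (k + 2) + g (int k - 1) * C (k + 1)
        - g (int k + 1) * (B (k + 1)^2 - 2 * al * B (k + 1) * b k + b k ^2 + al^2 - 1) = 0"
    and e3: "\<And>k. g (int k + 2) * c (k + 1) * (2 * al * B (k + 2) - b (k + 1) - b k)
        + g (int k + 1) * C (k + 2) * (2 * al * b k - B (k + 2) - B (k + 1)) = 0"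
    and e4: "\<And>k. 2 * al * g (int k + 2) * C (k + 3) * c (k + 1)
        - g (int k + 3) * c (k + 2) * c (k + 1) - g (int k + 1) * C (k + 3) * C (k + 2) = 0"
  obtains l m where "l \<noteq> 0 \<or> m \<noteq> 0"
    "\<And>k. qseq l m p (2 * int k + 5) * B (k + 2)
      - (qseq l m p (2 * int k + 3) + qseq l m p (2 * int k + 1)) * B (k + 1) + qseq l m p (2 * int k - 1) * B k = 0"
    "\<And>k. qseq l m p (2 * int k + 3) * (B (k + 2) - p^2 * B (k + 1)) * (B (k + 2) - inverse (p^2) * B (k + 1)) =
      (qseq l m p (2 * int k + 5) + qseq l m p (2 * int k + 7)) * (C (k + 3) - 1/4)
      - 4 * al^2 * qseq l m p (2 * int k + 3) * (C (k + 2) - 1/4)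
      + (qseq l m p (2 * int k + 1) + qseq l m p (2 * int k - 1)) * (C (k + 1) - 1/4)"
proof -
  have p2: "p^2 \<noteq> 1" using p(2) by (auto simp: power4_eq_xxxx power2_eq_square)
  have al2: "2 * al = p + 1 / p" by (simp add: al)
  have k0: "p - 1 / p \<noteq> 0" using p(1) p2 by (simp add: field_simps power2_eq_square)
  obtain l m where lm: "qseq l m p 1 = 1" "qseq l m p 2 = c 1 * g 2 / (C 2 * g 1)"
    using qseq_fit[OF p(1) p2] by blast
  define R where "R = qseq l m p"
  have lm0: "l \<noteq> 0 \<or> m \<noteq> 0" using lm(1) by (auto simp: qseq_def)
  have rec: "R (n + 1) = 2 * al * R n - R (n - 1)" "g (n + 1) = 2 * al * g n - g (n - 1)" for n
    using qseq_rec[OF p(1)] by (simp_all add: al2 R_def g_def qnum_eq_qseq)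
  have g01: "g 0 = 0" "g 1 = 1" using k0 by (simp_all add: g_def qnum_def power_int_minus field_simps)
  have ratio: "c k * g (int k + 1) * R (int k) = C (k + 1) * g (int k) * R (int k + 1)" for k
  proof -
    have "c k * g (int (k + 1)) * R (int k) = C (k + 1) * g (int k) * R (int (k + 1))"
    proof (rule coefficient_ratio[where g = "\<lambda>k. g (int k)" and R = "\<lambda>k. R (int k)" and ?al2.0 = "2 * al"])
      show "R (int (k + 2)) = 2 * al * R (int (k + 1)) - R (int k)" for k
        using rec(1)[of "int k + 1"] by (simp add: add.commute)
      show "R (int 2) = c 1 * g (int 2) / (C 2 * g (int 1))" "R (int 1) = 1"
        using lm by (simp_all add: R_def)
      show "g (int (Suc k)) \<noteq> 0" for k using gnz[of k] by (simp add: add.commute)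
      show "2 * al * g (int (k + 2)) * C (k + 3) * c (k + 1) - g (int (k + 3)) * c (k + 2) * c (k + 1)
          - g (int (k + 1)) * C (k + 3) * C (k + 2) = 0" for k
        using e4[of k] by (simp add: add.commute)
    qed (use C c g01 in auto)
    then show ?thesis by (simp add: add.commute)
  qed
  \<comment> \<open>This is \<open>e1\<close> shifted down by one, with \<open>e0\<close> supplying
    \<open>k = 0\<close>.\<close>
  have e1': "g (int k + 1) * B (k + 1) - g (int k - 1) * B k = g (int k + 2) * b k - (if k = 0 then 0 else g (int k) * b (k - 1))" for k
  proof (cases k)
    case 0
    have "g (-1) = -1" "g 2 = 2 * al" using rec(2)[of 0] rec(2)[of 1] g01 by (simp_all add: minus_equation_iff)
    then show ?thesis using 0 e0 g01 by simp
  next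
    case (Suc j)
    then show ?thesis using e1[of j] by (simp add: algebra_simps)
  qed
  have e3': "R (int k + 3) * B (k + 2) - R (int k + 1) * B (k + 1) = R (int k + 2) * b (k + 1) - R (int k) * b k" for k
  proof -
    have nz: "C (k + 2) * g (int k + 1) \<noteq> 0" using C[of "k + 1"] gnz[of k] by simp
    have r: "c (k + 1) * g (int k + 2) * R (int k + 1) = C (k + 2) * g (int k + 1) * R (int k + 2)"
      using ratio[of "k + 1"] by (simp add: add_ac)
    have s: "R (int k + 3) = 2 * al * R (int k + 2) - R (int k + 1)" "R (int k + 2) = 2 * al * R (int k + 1) - R (int k)"
      using rec(1)[of "int k + 2"] rec(1)[of "int k + 1"] by (simp_all add: add_ac)
    \<comment> \<open>After multiplication of \<open>e3\<close> by \<open>R (int k + 1)\<close>, the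
      ratio \<open>r\<close> gives both brackets the same factor, and the recurrence of
      \<open>R\<close> removes \<open>2 * al\<close>.\<close>
    have "(C (k + 2) * g (int k + 1)) * (R (int k + 3) * B (k + 2) - R (int k + 1) * B (k + 1))
      = (C (k + 2) * g (int k + 1)) * (R (int k + 2) * b (k + 1) - R (int k) * b k)"
      using e3[of k] r s by algebra
    then show ?thesis using nz mult_left_cancel by blast
  qed
  have Brec: "R (2 * int k + 5) * B (k + 2) - (R (2 * int k + 3) + R (2 * int k + 1)) * B (k + 1)
      + R (2 * int k - 1) * B k = 0" for k
  proof -
    have "R (2 * (int k + 1) + 3) * B (k + 2) - (R (2 * (int k + 1) + 1) + R (2 * (int k + 1) - 1)) * B (k + 1)
      + R (2 * (int k + 1) - 3) * B k = 0"
    proof (rule B_recurrence_step[OF p(1) p2, where l = l and m = m, folded R_def g_def])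
      \<comment> \<open>The value 0 stands in for \<open>b (-1)\<close>, which is always multiplied
        by \<open>g 0 = 0\<close>; the same factor makes the last goal below trivial at
        \<open>k = 0\<close>.\<close>
      let ?bm = "if k = 0 then 0 else b (k - 1)"
      show "g (int k + 1) * B (k + 1) - g (int k + 1 - 2) * B k = g (int k + 1 + 1) * b k - g (int k + 1 - 1) * ?bm"
        using e1'[of k] by (simp add: algebra_simps split: if_splits)
      show "g (int k + 1 + 1) * B (k + 2) - g (int k + 1 - 1) * B (k + 1) = g (int k + 1 + 2) * b (k + 1) - g (int k + 1) * b k"
        using e1[of k] by (simp add: algebra_simps)
      show "R (int k + 1 + 2) * B (k + 2) - R (int k + 1) * B (k + 1) = R (int k + 1 + 1) * b (k + 1) - R (int k + 1 - 1) * b k"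
        using e3'[of k] by (simp add: algebra_simps)
      show "g (int k + 1 - 1) * (R (int k + 1 + 1) * B (k + 1) - R (int k + 1 - 1) * B k)
        = g (int k + 1 - 1) * (R (int k + 1) * b k - R (int k + 1 - 2) * ?bm)"
      proof (cases k)
        case 0
        then show ?thesis by (simp add: g01)
      next
        case (Suc j)
        then show ?thesis using e3'[of j]
          by (intro arg_cong2[where f = "(*)"] refl) (simp add: algebra_simps)
      qed
    qed
    then show ?thesis by (simp add: algebra_simps)
  qed
  have Crec: "R (2 * int k + 3) * (B (k + 2) - p^2 * B (k + 1)) * (B (k + 2) - inverse (p^2) * B (k + 1)) =
      (R (2 * int k + 5) + R (2 * int k + 7)) * (C (k + 3) - 1/4)
      - 4 * al^2 * R (2 * int k + 3) * (C (k + 2) - 1/4)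
      + (R (2 * int k + 1) + R (2 * int k - 1)) * (C (k + 1) - 1/4)" for k
  proof -
    have n: "2 * (int k + 2) - 1 = 2 * int k + 3" "2 * (int k + 2) + 1 = 2 * int k + 5"
      "2 * (int k + 2) + 3 = 2 * int k + 7" "2 * (int k + 2) - 3 = 2 * int k + 1"
      "2 * (int k + 2) - 5 = 2 * int k - 1" "int k + 2 + 2 = int k + 4" "int k + 2 + 1 = int k + 3"
      "int k + 2 - 1 = int k + 1" "int k + 2 - 2 = int k" "int k + 2 - 3 = int k - 1" by simp_all
    note step = C_recurrence_step[OF p lm0 al, of "int k + 2", folded R_def g_def, unfolded n]
    show ?thesis
    proof (rule step)
      show "g (int k + 2) \<noteq> 0" using gnz[of "k + 1"] by (simp add: add_ac)
      show "g (int k + 2) * B (k + 2) - g (int k) * B (k + 1) = g (int k + 3) * b (k + 1) - g (int k + 1) * b k"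
        using e1[of k] by (simp add: algebra_simps)
      show "R (int k + 3) * B (k + 2) - R (int k + 1) * B (k + 1) = R (int k + 2) * b (k + 1) - R (int k) * b k"
        by (rule e3')
      show "g (int k + 4) * c (k + 2) - g (int k + 2) * c (k + 1) - g (int k + 2) * C (k + 3) + g (int k) * C (k + 2)
        = g (int k + 2) * (B (k + 2)^2 - 2 * al * B (k + 2) * b (k + 1) + b (k + 1)^2 + al^2 - 1)"
        using e2[of "k + 1"] by (simp add: add_ac numeral_3_eq_3)
      show "g (int k + 3) * c (k + 1) - g (int k + 1) * c k - g (int k + 1) * C (k + 2) + g (int k - 1) * C (k + 1)
        = g (int k + 1) * (B (k + 1)^2 - 2 * al * B (k + 1) * b k + b k^2 + al^2 - 1)"
        using e2[of k] by simp
      show "c (k + 2) * g (int k + 3) * R (int k + 2) = C (k + 3) * g (int k + 2) * R (int k + 3)"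
        using ratio[of "k + 2"] by (simp add: add_ac numeral_3_eq_3)
      show "c (k + 1) * g (int k + 2) * R (int k + 1) = C (k + 2) * g (int k + 1) * R (int k + 2)"
        using ratio[of "k + 1"] by (simp add: add_ac)
      show "c k * g (int k + 1) * R (int k) = C (k + 1) * g (int k) * R (int k + 1)"
        by (rule ratio)
    qed
  qed
  show ?thesis using that lm0 Brec Crec unfolding R_def by blast
qed

subsection \<open>Orthogonal polynomials and the Askey--Wilson operator\<close>

lemma dual_space_linear:
  assumes "u \<in> dual_space"
  shows "u (f + g) = u f + u g" and "u (smult c f) = c * u f" and "u (f - g) = u f - u g" and "u 0 = 0"
proof -
  have "Vector_Spaces.linear smult (*) u" using assms by (simp add: dual_space_def)
  then have h: "module_hom smult (*) u" by (rule Vector_Spaces.linear.axioms(3))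
  show "u (f + g) = u f + u g" "u (smult c f) = c * u f" "u (f - g) = u f - u g" "u 0 = 0"
    using module_hom.add[OF h] module_hom.scale[OF h] module_hom.diff[OF h] module_hom.zero[OF h] by auto
qed

text \<open>Subtracting multiples of the \<open>Q m\<close> lowers the degree of \<open>f\<close>
  step by step, and orthogonality to \<open>Q n\<close> lets only the step \<open>m = n\<close>
  contribute.\<close>

lemma functional_times_monic_ops:
  assumes u: "u \<in> dual_space"
    and orth: "\<And>n m. u (Q n * Q m) = (if n = m then \<kappa> n else 0)"
    and Q: "\<And>n. degree (Q n) = n" "\<And>n. coeff (Q n) n = 1"
    and f: "degree f \<le> n"
  shows "u (f * Q n) = coeff f n * \<kappa> n"
proof -
  have "u (f * Q n) = (if m = n then coeff f n * \<kappa> n else 0)" if "degree f \<le> m" "m \<le> n" for m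
    using that
  proof (induction m arbitrary: f rule: less_induct)
    case (less m)
    define g where "g = f - smult (coeff f m) (Q m)"
    have f: "f * Q n = g * Q n + smult (coeff f m) (Q m * Q n)"
      by (simp add: g_def algebra_simps)
    have "degree g \<le> m" unfolding g_def
      by (intro degree_diff_le less.prems order.trans[OF degree_smult_le]) (simp add: Q)
    moreover have "coeff g m = 0" by (simp add: g_def Q)
    ultimately have "g = 0 \<or> degree g < m"
      by (metis eq_zero_or_degree_less)
    then have "u (g * Q n) = 0"
      using less.IH[of "degree g" g] less.prems(2) dual_space_linear(4)[OF u] by auto
    then show ?case
      unfolding f by (simp add: dual_space_linear[OF u] orth)
  qed
  from this[OF f] show ?thesis by simp
qed

text \<open>The defect \<open>h\<close> of the recurrence has degree at most \<open>n\<close>.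
  Pairing it with \<open>Q d\<close> for \<open>d = degree h\<close> gives 0 and also the leading
  coefficient times \<open>\<kappa> d\<close>, so \<open>h = 0\<close>.\<close>

lemma monic_ops_recurrence:
  assumes u: "u \<in> dual_space"
    and orth: "\<And>n m. u (Q n * Q m) = (if n = m then \<kappa> n else 0)" "\<And>n. \<kappa> n \<noteq> 0"
    and Q: "\<And>n. degree (Q n) = n" "\<And>n. coeff (Q n) n = 1"
  obtains B C where "C 0 = 0" "\<And>n. C (Suc n) \<noteq> 0"
    "\<And>n. [:0, 1:] * Q n = Q (n + 1) + smult (B n) (Q n) + smult (C n) (if n = 0 then 0 else Q (n - 1))"
proof -
  note lin = dual_space_linear[OF u] and uQ = functional_times_monic_ops[OF u orth(1) Q]
  \<comment> \<open>Pairing the recurrence with \<open>Q n\<close> and \<open>Q (n - 1)\<close>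
    forces these values.\<close>
  define B where "B n = u ([:0, 1:] * Q n * Q n) / \<kappa> n" for n
  define C where "C n = (if n = 0 then 0 else \<kappa> n / \<kappa> (n - 1))" for n
  have "[:0, 1:] * Q n = Q (n + 1) + smult (B n) (Q n) + smult (C n) (if n = 0 then 0 else Q (n - 1))" for n
  proof -
    define R where "R = (if n = 0 then 0 else Q (n - 1))"
    define h where "h = [:0, 1:] * Q n - Q (n + 1) - smult (B n) (Q n) - smult (C n) R"
    have dR: "degree R \<le> n" using Q by (auto simp: R_def)
    have Q0: "coeff (Q i) j = 0" if "i < j" for i j using that Q by (simp add: coeff_eq_0)
    have deg: "coeff h j = 0" if "j > n" for j
    proof (cases "j = n + 1")
      case True
      then show ?thesis using dR by (simp add: h_def Q Q0 coeff_eq_0)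
    next
      case False
      then have "j > n + 1" "j - 1 > n" using that by auto
      then show ?thesis using that dR by (cases j) (simp_all add: h_def Q0 coeff_eq_0)
    qed
    have "h = 0"
    proof (rule ccontr)
      assume h: "h \<noteq> 0"
      define d where "d = degree h"
      have d: "d \<le> n" using deg h unfolding d_def by (meson leading_coeff_0_iff not_le)
      have "u (h * Q d) = u ([:0, 1:] * Q n * Q d) - u (Q (n + 1) * Q d) - B n * u (Q n * Q d) - C n * u (R * Q d)"
        unfolding h_def left_diff_distrib mult_smult_left lin(2,3) ..
      also have "\<dots> = 0"
      proof -
        consider "d = n" | "d + 1 = n" | "d + 1 < n" using d by linarith
        then show ?thesis
        proof cases
          case 1
          have "u (R * Q n) = 0" by (auto simp: R_def lin orth(1))
          then show ?thesis using 1 orth by (simp add: B_def)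
        next
          case 2
          have c: "[:0, 1:] * Q n * Q d = ([:0, 1:] * Q d) * Q n" by (simp add: mult_ac)
          have "u (([:0, 1:] * Q d) * Q n) = \<kappa> n"
            by (subst uQ) (use 2 Q in \<open>auto simp: degree_pCons_eq_if\<close>)
          then show ?thesis unfolding c using 2 orth by (auto simp: R_def C_def)
        next
          case 3
          have c: "[:0, 1:] * Q n * Q d = ([:0, 1:] * Q d) * Q n" by (simp add: mult_ac)
          have "u (([:0, 1:] * Q d) * Q n) = 0"
            by (subst uQ) (use 3 Q Q0 in \<open>auto simp: degree_pCons_eq_if coeff_pCons split: nat.split\<close>)
          then show ?thesis unfolding c using 3 orth by (auto simp: R_def)
        qed
      qed
      finally have "coeff h d * \<kappa> d = 0" using uQ[of h d] d_def by simp
      then show False using h orth(2) by (simp add: d_def)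
    qed
    then show ?thesis unfolding h_def R_def by (simp add: algebra_simps)
  qed
  moreover have "C 0 = 0" "C (Suc n) \<noteq> 0" for n using orth(2) by (simp_all add: C_def)
  ultimately show ?thesis using that by blast
qed

section \<open>Algebra of the Askey-Wilson operator\<close>

lemma askey_wilson_eqI:
  assumes "0 < q" "q < 1" "is_askey_wilson q f g"
  shows "askey_wilson q f = g"
  using askey_wilson_ex1[OF assms(1,2)] is_askey_wilson_askey_wilson[OF assms(1,2)] assms(3) by blast

lemma askey_wilson_add:
  assumes q: "0 < q" "q < 1"
  shows "askey_wilson q (f + g) = askey_wilson q f + askey_wilson q g"
  using is_askey_wilson_askey_wilson[OF q, of f] is_askey_wilson_askey_wilson[OF q, of g]
  by (intro askey_wilson_eqI q)
     (simp add: is_askey_wilson_def breve_def flip: add_divide_distrib)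

lemma askey_wilson_smult:
  assumes q: "0 < q" "q < 1"
  shows "askey_wilson q (smult c f) = smult c (askey_wilson q f)"
  using is_askey_wilson_askey_wilson[OF q, of f]
  by (intro askey_wilson_eqI q)
     (simp add: is_askey_wilson_def breve_def flip: right_diff_distrib)

lemma askey_wilson_const:
  assumes q: "0 < q" "q < 1"
  shows "askey_wilson q [:c:] = 0"
  by (intro askey_wilson_eqI q) (simp add: is_askey_wilson_def breve_def)

lemma askey_wilson_x:
  assumes q: "0 < q" "q < 1"
  shows "askey_wilson q [:0, 1:] = 1"
  by (intro askey_wilson_eqI q) (simp add: is_askey_wilson_def breve_def)

text \<open>The nodes \<open>e (s * z)\<close> and \<open>e (t * z)\<close> are the roots of a
  quadratic with sum \<open>2 * \<alpha> * x\<close> and product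
  \<open>x^2 + \<alpha>^2 - 1\<close>, so their squares reduce to first powers. This is the rule for
  \<open>S (x f)\<close> written with \<open>D\<close> alone.\<close>

lemma askey_wilson_x_x_mult:
  assumes q: "0 < q" "q < 1" and \<alpha>: "\<alpha> = (qpow q (1/2) + qpow q (-1/2)) / 2"
  shows "askey_wilson q ([:0, 1:] * ([:0, 1:] * f)) =
    smult (2 * \<alpha>) ([:0, 1:] * askey_wilson q ([:0, 1:] * f)) - [:\<alpha>^2 - 1, 0, 1:] * askey_wilson q f"
proof (intro askey_wilson_eqI q, unfold is_askey_wilson_def, intro allI impI)
  fix z :: complex
  define s t where "s = qpow q (1/2)" and "t = qpow q (-1/2)"
  define e where "e = (\<lambda>z::complex. (z + 1 / z) / 2)"
  define d where "d = e (s * z) - e (t * z)"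
  define F where "F = (\<lambda>z. poly f (e z))"
  assume z: "z \<noteq> 0" and "breve [:0, 1:] (qpow q (1/2) * z) - breve [:0, 1:] (qpow q (-1/2) * z) \<noteq> 0"
  then have d: "d \<noteq> 0" by (simp add: d_def e_def s_def t_def breve_def)
  have st: "s * t = 1" using askey_wilson_denominator(2)[OF q z] by (simp only: s_def t_def)
  then have "s \<noteq> 0" by auto
  with st have t: "t = 1 / s" "s \<noteq> 0" by (simp_all add: field_simps)
  have sum: "e (s * z) + e (t * z) = 2 * \<alpha> * e z"
    unfolding \<alpha> s_def[symmetric] t_def[symmetric] e_def t(1) using z t(2) by (simp add: field_simps)
  have prd: "e (s * z) * e (t * z) = (e z)^2 + \<alpha>^2 - 1"
    unfolding \<alpha> s_def[symmetric] t_def[symmetric] e_def t(1) using z t(2)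
    by (simp add: field_simps power2_eq_square)
  have D: "d * poly (askey_wilson q g) (e z) = poly g (e (s * z)) - poly g (e (t * z))" for g
    using is_askey_wilson_askey_wilson[OF q, of g] z d
    by (simp add: is_askey_wilson_def breve_def d_def e_def s_def t_def)
  have "d * (2 * \<alpha> * e z * poly (askey_wilson q ([:0, 1:] * f)) (e z)
      - (e z ^2 + \<alpha>^2 - 1) * poly (askey_wilson q f) (e z)) =
    (e (s * z))^2 * F (s * z) - (e (t * z))^2 * F (t * z)"
    using D[of f] D[of "[:0, 1:] * f"] sum prd unfolding F_def poly_mult by simp algebra
  then have "poly (smult (2 * \<alpha>) ([:0, 1:] * askey_wilson q ([:0, 1:] * f)) - [:\<alpha>^2 - 1, 0, 1:] * askey_wilson q f) (e z)
    = ((e (s * z))^2 * F (s * z) - (e (t * z))^2 * F (t * z)) / d"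
    using d by (simp add: field_simps power2_eq_square)
  then show "poly (smult (2 * \<alpha>) ([:0, 1:] * askey_wilson q ([:0, 1:] * f)) - [:\<alpha>^2 - 1, 0, 1:] * askey_wilson q f) ((z + 1 / z) / 2)
    = (breve ([:0, 1:] * ([:0, 1:] * f)) (qpow q (1/2) * z) - breve ([:0, 1:] * ([:0, 1:] * f)) (qpow q (-1/2) * z)) /
       (breve [:0, 1:] (qpow q (1/2) * z) - breve [:0, 1:] (qpow q (-1/2) * z))"
    by (simp add: d_def e_def s_def t_def F_def breve_def power2_eq_square mult.assoc)
qed

lemma qpow_half:
  assumes "0 < q" "q < 1"
  shows "qpow q (1/2) \<noteq> 0" and "1 / qpow q (1/2) = qpow q (-1/2)"
    and "qpow q (1/2) - 1 / qpow q (1/2) \<noteq> 0"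
proof -
  have "qpow q (1/2) * qpow q (-1/2) = 1"
    by (rule askey_wilson_denominator(2)[OF assms one_neq_zero])
  then show 0: "qpow q (1/2) \<noteq> 0" and 1: "1 / qpow q (1/2) = qpow q (-1/2)"
    by (metis mult_zero_left zero_neq_one, metis nonzero_mult_div_cancel_left mult_zero_left zero_neq_one)
  show "qpow q (1/2) - 1 / qpow q (1/2) \<noteq> 0"
    unfolding 1 by (rule askey_wilson_denominator(3)[OF assms one_neq_zero])
qed

text \<open>Multiplying \<open>D f\<close> by \<open>x\<close> expresses the degree drop without
  \<open>n - 1\<close> and includes constants. The two parts need a joint induction, since the rule
  for \<open>D (x (x g))\<close> involves both \<open>D (x g)\<close> and \<open>D g\<close>; the
  top coefficients follow the recurrence of \<open>qnum\<close>.\<close>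

lemma coeff_askey_wilson:
  assumes q: "0 < q" "q < 1" and f: "degree f \<le> n" and k: "n \<le> k"
  shows "coeff ([:0, 1:] * askey_wilson q f) k = (if k = n then qnum (qpow q (1/2)) (int n) * coeff f n else 0)"
    and "coeff (askey_wilson q ([:0, 1:] * f)) k = (if k = n then qnum (qpow q (1/2)) (int n + 1) * coeff f n else 0)"
proof -
  define p where "p = qpow q (1/2)"
  define \<alpha> where "\<alpha> = (qpow q (1/2) + qpow q (-1/2)) / 2"
  define D where "D = askey_wilson q"
  note p = qpow_half(1)[OF q, folded p_def] and p1 = qpow_half(2)[OF q, folded p_def]
    and k0 = qpow_half(3)[OF q, folded p_def]
  have rec: "qnum p (n + 1) = 2 * \<alpha> * qnum p n - qnum p (n - 1)" for n
  proof -
    have "2 * \<alpha> = p + 1 / p" unfolding p1 \<alpha>_def unfolding p_def by simp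
    then show ?thesis using qseq_rec[OF p] by (simp only: qnum_eq_qseq)
  qed
  have g01: "qnum p 0 = 0" "qnum p 1 = 1" using k0 by (simp_all add: qnum_def power_int_minus field_simps)
  have "(\<forall>k\<ge>n. coeff ([:0, 1:] * D f) k = (if k = n then qnum p (int n) * coeff f n else 0)) \<and>
    (\<forall>k\<ge>n. coeff (D ([:0, 1:] * f)) k = (if k = n then qnum p (int n + 1) * coeff f n else 0))"
    using f
  proof (induction n arbitrary: f)
    case 0
    then obtain c where f: "f = [:c:]" by (metis degree_0_id le_zero_eq)
    have "[:0, 1:] * f = smult c [:0, 1:]" by (simp add: f)
    then have "D ([:0, 1:] * f) = [:c:]" "D f = 0"
      using askey_wilson_smult[OF q, of c "[:0, 1:]"] askey_wilson_x[OF q] askey_wilson_const[OF q]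
      by (simp_all add: D_def f)
    then show ?case by (auto simp: f g01 coeff_pCons split: nat.split)
  next
    case (Suc n)
    obtain a g where f: "f = pCons a g" by (rule pCons_cases)
    have g: "degree g \<le> n" using Suc.prems by (auto simp: f degree_pCons_eq_if split: if_splits)
    note IH = conjunct1[OF Suc.IH[OF g], rule_format] conjunct2[OF Suc.IH[OF g], rule_format]
    have fg: "f = [:a:] + [:0, 1:] * g" by (simp add: f)
    have Df: "D f = D ([:0, 1:] * g)"
      unfolding D_def fg by (subst askey_wilson_add[OF q], subst askey_wilson_const[OF q]) simp
    have xf: "[:0, 1:] * f = smult a [:0, 1:] + [:0, 1:] * ([:0, 1:] * g)" by (simp add: f)
    have Dxf: "D ([:0, 1:] * f) = [:a:] + (smult (2 * \<alpha>) ([:0, 1:] * D ([:0, 1:] * g)) - [:\<alpha>^2 - 1, 0, 1:] * D g)"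
      unfolding D_def xf by (subst askey_wilson_add[OF q], subst askey_wilson_x_x_mult[OF q \<alpha>_def])
        (use askey_wilson_smult[OF q, of a "[:0, 1:]"] askey_wilson_x[OF q] in simp)
    have Dg: "coeff (D g) k = 0" if "k \<ge> n" for k using IH(1)[of "Suc k"] that by simp
    have 1: "coeff ([:0, 1:] * D f) k = (if k = Suc n then qnum p (int (Suc n)) * coeff f (Suc n) else 0)"
      if "k \<ge> Suc n" for k
      using that IH(2)[of "k - 1"] Df by (cases k) (auto simp: f add.commute)
    have 2: "coeff (D ([:0, 1:] * f)) k = (if k = Suc n then qnum p (int (Suc n) + 1) * coeff f (Suc n) else 0)"
      if "k \<ge> Suc n" for k
    proof -
      define j where "j = k - 1"
      have k: "k = Suc j" "j \<ge> n" using that by (simp_all add: j_def)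
      \<comment> \<open>Only the term \<open>x^2\<close> counts here, since \<open>D g\<close> has
        no coefficients from \<open>n\<close> on.\<close>
      have "coeff ([:\<alpha>^2 - 1, 0, 1:] * D g) k = coeff ([:0, 1:] * D g) j"
        using k Dg[of k] by (simp add: coeff_pCons split: nat.split)
      then have "coeff (D ([:0, 1:] * f)) k = 2 * \<alpha> * coeff (D ([:0, 1:] * g)) j - coeff ([:0, 1:] * D g) j"
        unfolding Dxf by (simp add: k)
      also have "\<dots> = (if j = n then (2 * \<alpha> * qnum p (int n + 1) - qnum p (int n)) * coeff g n else 0)"
        using IH k by (simp add: algebra_simps)
      also have "2 * \<alpha> * qnum p (int n + 1) - qnum p (int n) = qnum p (int (Suc n) + 1)"
        using rec[of "int n + 1"] by (simp add: add.commute)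
      finally show ?thesis by (simp add: k(1) f)
    qed
    show ?case using 1 2 by blast
  qed
  then show "coeff ([:0, 1:] * askey_wilson q f) k = (if k = n then qnum (qpow q (1/2)) (int n) * coeff f n else 0)"
    "coeff (askey_wilson q ([:0, 1:] * f)) k = (if k = n then qnum (qpow q (1/2)) (int n + 1) * coeff f n else 0)"
    using k by (simp_all add: D_def p_def)
qed

section \<open>The five-term relation and comparison of coefficients\<close>

text \<open>
  Here \<open>v\<^sub>0, \<dots>, v\<^sub>4\<close> stand for \<open>Q\<^sub>n\<^sub>-\<^sub>3(t), \<dots>, Q\<^sub>n\<^sub>+\<^sub>1(t)\<close>. The recurrence for \<open>t v1\<close> is only assumed up to the
  factors \<open>gm1\<close> and \<open>c1\<close>, which vanish when \<open>v1 = Q\<^sub>-\<^sub>1 = 0\<close> and the recurrence fails.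
\<close>

lemma five_term:
  fixes t al v0 v1 v2 v3 v4 :: complex
  assumes g: "gp2 = 2 * al * gp1 - g" "gm1 = 2 * al * g - gp1" "gm2 = 2 * al * gm1 - g"
    and s: "sp = gp2 * v4 + (Bp - al * t) * gp1 * v3 + Cp * g * v2"
      "s0 = gp1 * v3 + (B - al * t) * g * v2 + C * gm1 * v1"
      "sm = g * v2 + (Bm - al * t) * gm1 * v1 + Cm * gm2 * v0"
    and eq: "(al^2 - 1) * (t^2 - 1) * (g * v2) + al * t * s0 = sp + B * s0 + C * sm"
    and r3: "t * v3 = v4 + b0 * v3 + c0 * v2" and r2: "t * v2 = v3 + b1 * v2 + c1 * v1"
    and r1: "gm1 * (t * v1) = gm1 * (v2 + b2 * v1 + c2 * v0)" "c1 * (t * v1) = c1 * (v2 + b2 * v1 + c2 * v0)"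
  shows "(gp2 * b0 - g * b1 - gp1 * Bp + gm1 * B) * v3
     + (gp2 * c0 - g * c1 - g * Cp + gm2 * C - g * (B^2 - 2 * al * B * b1 + b1^2 + al^2 - 1)) * v2
     + (g * c1 * (2 * al * B - b1 - b2) + gm1 * C * (2 * al * b2 - B - Bm)) * v1
     + (2 * al * gm1 * C * c2 - g * c1 * c2 - gm2 * C * Cm) * v0 = 0"
  using assms by algebra

text \<open>
  The index shift \<open>W j = Q (j - 2)\<close>, with \<open>W 0 = W 1 = 0\<close>, provides \<open>Q\<^sub>-\<^sub>1 = Q\<^sub>-\<^sub>2 = 0\<close>.
\<close>

lemma four_term_independent:
  fixes Q :: "nat \<Rightarrow> complex poly"
  defines "W \<equiv> \<lambda>j. if j < 2 then 0 else Q (j - 2)"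
  assumes Q: "\<And>n. degree (Q n) = n" "\<And>n. coeff (Q n) n = 1"
    and eq: "\<And>t. a3 * poly (W (k + 3)) t + a2 * poly (W (k + 2)) t + a1 * poly (W (k + 1)) t + a0 * poly (W k) t = 0"
  shows "a3 = 0" and "a2 = 0" and "k \<ge> 1 \<Longrightarrow> a1 = 0" and "k \<ge> 2 \<Longrightarrow> a0 = 0"
proof -
  have W: "coeff (W j) i = 0" if "j < i + 2" for i j
    using that by (auto simp: W_def coeff_eq_0 Q)
  have W1: "coeff (W j) i = 1" if "j = i + 2" for i j using that by (simp add: W_def Q)
  have "poly (smult a3 (W (k + 3)) + smult a2 (W (k + 2)) + smult a1 (W (k + 1)) + smult a0 (W k)) t = poly 0 t" for t
    using eq[of t] by simp
  then have p0: "smult a3 (W (k + 3)) + smult a2 (W (k + 2)) + smult a1 (W (k + 1)) + smult a0 (W k) = 0"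
    by (intro poly_ext)
  have c: "a3 * coeff (W (k + 3)) i + a2 * coeff (W (k + 2)) i + a1 * coeff (W (k + 1)) i + a0 * coeff (W k) i = 0" for i
    using arg_cong[OF p0, of "\<lambda>f. coeff f i"] by simp
  \<comment> \<open>\<open>W (k + 3) = Q (k + 1)\<close> has the highest degree, so the coefficients
    at \<open>k + 1\<close>, \<open>k\<close>, \<open>k - 1\<close>, \<open>k - 2\<close> isolate
    \<open>a3\<close>, \<open>a2\<close>, \<open>a1\<close>, \<open>a0\<close> in turn.\<close>
  show a3: "a3 = 0" using c[of "k + 1"] by (simp add: W W1)
  show a2: "a2 = 0" using c[of k] a3 by (simp add: W W1)
  show a1: "a1 = 0" if "k \<ge> 1" using c[of "k - 1"] a3 a2 that by (simp add: W W1)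
  show "a0 = 0" if "k \<ge> 2" using c[of "k - 2"] a3 a2 a1 that by (simp add: W W1)
qed

text \<open>\<open>D (x (x P))\<close> at \<open>P (k + 1)\<close> is computed once by the
  recurrence of \<open>P\<close> and once by \<open>askey_wilson_x_x_mult\<close>; the recurrence of
  \<open>Q\<close> then removes the factors \<open>t\<close>.\<close>

lemma askey_wilson_five_term:
  fixes q :: real and P Q :: "nat \<Rightarrow> complex poly" and B C b c :: "nat \<Rightarrow> complex"
  defines "g \<equiv> qnum (qpow q (1/2))" and "W \<equiv> \<lambda>j. if j < 2 then 0 else Q (j - 2)"
  assumes q: "0 < q" "q < 1" and \<alpha>: "\<alpha> = (qpow q (1/2) + qpow q (-1/2)) / 2"
    and P0: "P 0 = 1"
    and P: "\<And>n. [:0, 1:] * P n = P (n + 1) + smult (B n) (P n) + smult (C n) (if n = 0 then 0 else P (n - 1))"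
    and D: "\<And>n. askey_wilson q (P (Suc n)) = smult (g (int n + 1)) (Q n)"
    and Q: "\<And>n. [:0, 1:] * Q n = Q (n + 1) + smult (b n) (Q n) + smult (c n) (if n = 0 then 0 else Q (n - 1))"
    and c0: "c 0 = 0"
  shows "(g (int k + 3) * b (k + 1) - g (int k + 1) * b k - g (int k + 2) * B (k + 2) + g (int k) * B (k + 1)) * poly (W (k + 3)) t
    + (g (int k + 3) * c (k + 1) - g (int k + 1) * c k - g (int k + 1) * C (k + 2) + g (int k - 1) * C (k + 1)
        - g (int k + 1) * (B (k + 1)^2 - 2 * \<alpha> * B (k + 1) * b k + b k ^2 + \<alpha>^2 - 1)) * poly (W (k + 2)) t
    + (g (int k + 1) * c k * (2 * \<alpha> * B (k + 1) - b k - b (k - 1))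
        + g (int k) * C (k + 1) * (2 * \<alpha> * b (k - 1) - B (k + 1) - B k)) * poly (W (k + 1)) t
    + (2 * \<alpha> * g (int k) * C (k + 1) * c (k - 1)
        - g (int k + 1) * c k * c (k - 1) - g (int k - 1) * C (k + 1) * C k) * poly (W k) t = 0"
proof -
  define p where "p = qpow q (1/2)"
  note p = qpow_half(1)[OF q, folded p_def] and p1 = qpow_half(2)[OF q, folded p_def]
  have al2: "2 * \<alpha> = p + 1 / p" unfolding p1 \<alpha> unfolding p_def by simp
  have rec: "g (n + 1) = 2 * \<alpha> * g n - g (n - 1)" for n
    unfolding al2 g_def p_def[symmetric] qnum_eq_qseq by (rule qseq_rec[OF p])
  have g0: "g 0 = 0" by (simp add: g_def qnum_def)
  define D where "D = askey_wilson q"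
  define x :: "complex poly" where "x = [:0, 1:]"
  define Pm where "Pm = (\<lambda>n. if n = 0 then 0 else P (n - 1))"
  have P': "x * P n = P (n + 1) + smult (B n) (P n) + smult (C n) (Pm n)" for n
    using P by (simp add: x_def Pm_def)
  have D_lin: "D (f + h) = D f + D h" "D (smult a f) = smult a (D f)" for f h a
    by (simp_all only: D_def askey_wilson_add[OF q] askey_wilson_smult[OF q])
  have D0: "D 0 = 0" "D 1 = 0" using askey_wilson_const[OF q, of 0] askey_wilson_const[OF q, of 1]
    by (simp_all add: D_def one_pCons)
  \<comment> \<open>\<open>d n\<close> and \<open>s n\<close> are the values at \<open>t\<close> of
    \<open>D\<close> and of the averaging operator \<open>S\<close> on \<open>P n\<close>.\<close>
  define d where "d n = poly (D (P n)) t" for n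
  define s where "s n = poly (D (x * P n)) t - \<alpha> * t * d n" for n
  have dW: "d n = g (int n) * poly (W (n + 1)) t" for n
    using D P0 by (cases n) (simp_all add: d_def D_def[symmetric] D0 g0 W_def add.commute)
  have dm: "poly (D (Pm n)) t = g (int n - 1) * poly (W n) t" for n
    using dW[of "n - 1"] by (cases n) (auto simp: Pm_def D0 d_def W_def)
  have dxP: "poly (D (x * P n)) t = d (n + 1) + B n * d n + C n * poly (D (Pm n)) t" for n
    unfolding P' D_lin by (simp add: d_def)
  have s: "s n = g (int n + 1) * poly (W (n + 2)) t + (B n - \<alpha> * t) * g (int n) * poly (W (n + 1)) t
      + C n * g (int n - 1) * poly (W n) t" for n
    unfolding s_def dxP dW dm by (simp add: algebra_simps)
  have second: "poly (D (x * (x * f))) t = 2 * \<alpha> * t * poly (D (x * f)) t - (t^2 + \<alpha>^2 - 1) * poly (D f) t" for f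
    unfolding D_def x_def askey_wilson_x_x_mult[OF q \<alpha>] by (simp add: algebra_simps power2_eq_square)
  have "x * (x * P (k + 1)) = x * P (k + 2) + smult (B (k + 1)) (x * P (k + 1)) + smult (C (k + 1)) (x * P k)"
    by (subst P') (simp add: algebra_simps Pm_def)
  then have "poly (D (x * (x * P (k + 1)))) t = poly (D (x * P (k + 2))) t + B (k + 1) * poly (D (x * P (k + 1))) t
      + C (k + 1) * poly (D (x * P k)) t"
    by (simp add: D_lin)
  moreover have "poly (D (x * P (k + 2))) t = s (k + 2) + \<alpha> * t * d (k + 2)"
    "poly (D (x * P (k + 1))) t = s (k + 1) + \<alpha> * t * d (k + 1)"
    "poly (D (x * P k)) t = s k + \<alpha> * t * d k" by (simp_all add: s_def)
  moreover have "d (k + 2) + B (k + 1) * d (k + 1) + C (k + 1) * d k = s (k + 1) + \<alpha> * t * d (k + 1)"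
    using dxP[of "k + 1"] by (simp add: s_def Pm_def d_def)
  ultimately have eq: "(\<alpha>^2 - 1) * (t^2 - 1) * d (k + 1) + \<alpha> * t * s (k + 1) = s (k + 2) + B (k + 1) * s (k + 1) + C (k + 1) * s k"
    using second[of "P (k + 1)"] unfolding d_def[symmetric] by algebra
  have WQ: "t * poly (W (j + 2)) t = poly (W (j + 3)) t + b j * poly (W (j + 2)) t + c j * poly (W (j + 1)) t" for j
    using arg_cong[OF Q[of j], of "\<lambda>f. poly f t"] c0
    by (cases j) (simp_all add: W_def numeral_3_eq_3)
  \<comment> \<open>At \<open>k = 0\<close> the equation would read \<open>0 = Q 0\<close>; there
    the factors \<open>g 0\<close> and \<open>c 0\<close> take its place below.\<close>
  have W1: "k = 0 \<or> t * poly (W (k + 1)) t = poly (W (k + 2)) t + b (k - 1) * poly (W (k + 1)) t + c (k - 1) * poly (W k) t"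
    using WQ[of "k - 1"] by (cases k) (simp_all add: numeral_3_eq_3)
  show ?thesis
  proof (rule five_term[where ?v4.0 = "poly (W (k + 4)) t" and t = t and sp = "s (k + 2)" and ?s0.0 = "s (k + 1)" and sm = "s k"])
    show "g (int k + 3) = 2 * \<alpha> * g (int k + 2) - g (int k + 1)" using rec[of "int k + 2"] by (simp add: add_ac)
    show "g (int k) = 2 * \<alpha> * g (int k + 1) - g (int k + 2)" using rec[of "int k + 1"] by (simp add: add_ac)
    show "g (int k - 1) = 2 * \<alpha> * g (int k) - g (int k + 1)" using rec[of "int k"] by simp
    show "s (k + 2) = g (int k + 3) * poly (W (k + 4)) t + (B (k + 2) - \<alpha> * t) * g (int k + 2) * poly (W (k + 3)) t
        + C (k + 2) * g (int k + 1) * poly (W (k + 2)) t"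
      using s[of "k + 2"] by (simp add: add_ac eval_nat_numeral)
    show "s (k + 1) = g (int k + 2) * poly (W (k + 3)) t + (B (k + 1) - \<alpha> * t) * g (int k + 1) * poly (W (k + 2)) t
        + C (k + 1) * g (int k) * poly (W (k + 1)) t"
      using s[of "k + 1"] by (simp add: add_ac eval_nat_numeral)
    show "s k = g (int k + 1) * poly (W (k + 2)) t + (B k - \<alpha> * t) * g (int k) * poly (W (k + 1)) t
        + C k * g (int k - 1) * poly (W k) t" by (rule s)
    show "(\<alpha>^2 - 1) * (t^2 - 1) * (g (int k + 1) * poly (W (k + 2)) t) + \<alpha> * t * s (k + 1)
        = s (k + 2) + B (k + 1) * s (k + 1) + C (k + 1) * s k"
      using eq dW[of "k + 1"] by (simp add: add_ac)
    show "t * poly (W (k + 3)) t = poly (W (k + 4)) t + b (k + 1) * poly (W (k + 3)) t + c (k + 1) * poly (W (k + 2)) t"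
      using WQ[of "k + 1"] by (simp add: eval_nat_numeral)
    show "t * poly (W (k + 2)) t = poly (W (k + 3)) t + b k * poly (W (k + 2)) t + c k * poly (W (k + 1)) t"
      by (rule WQ)
    show "g (int k) * (t * poly (W (k + 1)) t) = g (int k) * (poly (W (k + 2)) t + b (k - 1) * poly (W (k + 1)) t + c (k - 1) * poly (W k) t)"
      "c k * (t * poly (W (k + 1)) t) = c k * (poly (W (k + 2)) t + b (k - 1) * poly (W (k + 1)) t + c (k - 1) * poly (W k) t)"
      using W1 g0 c0 by auto
  qed
qed

section \<open>The recurrences for \<open>B\<close> and \<open>C\<close> with explicit
  \<open>r\<close>\<close>

theorem theorem3p3:
  fixes q :: real and \<alpha> :: complex
    and P :: "nat \<Rightarrow> complex poly" and B C :: "nat \<Rightarrow> complex"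
  assumes q: "0 < q" "q < 1"
    and \<alpha>: "\<alpha> = (qpow q (1/2) + qpow q (-1/2)) / 2"
    and ops: "monic_ops P"
    and ttrr: "\<And>n. [:0, 1:] * P n =
      P (n + 1) + smult (B n) (P n) + smult (C n) (if n = 0 then 0 else P (n - 1))"
    and C_nz: "\<And>n. C (n + 1) \<noteq> 0"
    and classical: "classical_ops q P"
  shows "\<exists>a b :: complex. cmod a + cmod b \<noteq> 0 \<and>
    (let Q = complex_of_real q; r = (\<lambda>n::nat. a * Q ^ n + b * Q powi (- int n)) in
      (\<forall>n. r (n + 3) * B (n + 2) - (r (n + 2) + r (n + 1)) * B (n + 1) + r n * B n = 0) \<and>
      (\<forall>n\<ge>2. r n * (B n - Q * B (n - 1)) * (B n - inverse Q * B (n - 1)) =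
          (r (n + 1) + r (n + 2)) * (C (n + 1) - 1/4)
          - 4 * \<alpha>\<^sup>2 * r n * (C n - 1/4)
          + (r (n - 1) + r (n - 2)) * (C (n - 1) - 1/4)))"
proof -
  define p where "p = qpow q (1/2)"
  note p = qpow_half(1)[OF q, folded p_def] and p1 = qpow_half(2)[OF q, folded p_def]
    and k0 = qpow_half(3)[OF q, folded p_def]
  have al: "\<alpha> = (p + 1 / p) / 2" unfolding p1 \<alpha> unfolding p_def ..
  have "q powr (1/2) * q powr (1/2) = q" using q by (simp flip: powr_add)
  then have pq: "p^2 = complex_of_real q" by (metis of_real_mult p_def power2_eq_square)
  have pn: "p ^ (2 * n) \<noteq> 1" if "n > 0" for n
  proof -
    have "q ^ n < 1" using q that by (simp add: power_less_one_iff)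
    then have "complex_of_real (q ^ n) \<noteq> 1" by (metis less_irrefl of_real_eq_1_iff)
    then show ?thesis by (simp add: power_mult pq)
  qed
  define g where "g = qnum p"
  have gnz: "g (int n + 1) \<noteq> 0" for n
  proof
    assume "g (int n + 1) = 0"
    then have "p powi (int (Suc n)) = p powi (- int (Suc n))" using k0 by (simp add: g_def qnum_def add.commute)
    then have "p ^ Suc n * p ^ Suc n = 1" using p unfolding power_int_minus power_int_of_nat by (simp add: field_simps)
    then show False using pn[of "Suc n"] by (metis mult_2 power_add zero_less_Suc)
  qed
  have "p^4 \<noteq> 1" using pn[of 2] by simp
  have degP: "degree (P n) = n" and lcP: "coeff (P n) n = 1" for n
    using ops unfolding monic_ops_def is_ops_def ops_wrt_def by metis+
  have P0: "P 0 = 1" using degP[of 0] lcP[of 0] by (metis degree_eq_zeroE coeff_pCons_0 pCons_one)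
  define D where "D = askey_wilson q"
  \<comment> \<open>By \<open>coeff_askey_wilson\<close> the leading coefficient of
    \<open>D (P (Suc n))\<close> is \<open>g (int n + 1)\<close>, so this rescaling is
    monic.\<close>
  define Q where "Q n = smult (1 / g (int n + 1)) (D (P (Suc n)))" for n
  have DQ: "D (P (Suc n)) = smult (g (int n + 1)) (Q n)" for n using gnz by (simp add: Q_def)
  obtain v \<kappa> where v: "v \<in> dual_space" and dD: "\<And>n. degree (D (P (Suc n))) = n"
    and \<kappa>: "\<And>n. \<kappa> n \<noteq> 0" "\<And>n m. v (D (P (Suc n)) * D (P (Suc m))) = (if n = m then \<kappa> n else 0)"
    using classical unfolding classical_ops_def is_ops_def ops_wrt_def D_def by blast
  have degQ: "degree (Q n) = n" for n using gnz dD by (simp add: Q_def)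
  have lcQ: "coeff (Q n) n = 1" for n
    using coeff_askey_wilson(1)[OF q, of "P (Suc n)" "Suc n" "Suc n"] gnz degP lcP
    by (simp add: Q_def D_def g_def p_def add.commute)
  have orth: "v (Q n * Q m) = (if n = m then \<kappa> n / g (int n + 1)^2 else 0)" for n m
    using \<kappa>(2) by (simp add: Q_def dual_space_linear[OF v] power2_eq_square)
  have \<kappa>': "\<kappa> n / g (int n + 1)^2 \<noteq> 0" for n using \<kappa>(1) gnz by simp
  obtain b c where c: "c 0 = 0" "\<And>n. c (Suc n) \<noteq> 0"
    and Qrec: "\<And>n. [:0, 1:] * Q n = Q (n + 1) + smult (b n) (Q n) + smult (c n) (if n = 0 then 0 else Q (n - 1))"
    using monic_ops_recurrence[OF v orth \<kappa>' degQ lcQ] by metis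
  note five = askey_wilson_five_term[OF q \<alpha> P0 ttrr DQ[unfolded D_def g_def p_def] Qrec c(1), folded p_def, folded g_def]
  note indep = four_term_independent[OF degQ lcQ, OF five]
  \<comment> \<open>The five-term relation starts with \<open>D (x (x P))\<close> at
    \<open>P 1\<close>; this relation, belonging to \<open>P 0\<close>, comes from evaluating
    \<open>D (x * P 1)\<close> in two ways.\<close>
  have e0: "2 * \<alpha> * b 0 = B 0 + B 1"
  proof -
    have Q0: "Q 0 = 1" using degQ[of 0] lcQ[of 0] by (metis degree_eq_zeroE coeff_pCons_0 pCons_one)
    have g: "g 1 = 1" using k0 by (simp add: g_def qnum_def power_int_minus inverse_eq_divide)
    have "g 2 = 2 * \<alpha>" using qseq_rec[OF p, of _ _ 1] g
      by (simp add: g_def qnum_eq_qseq al) (simp add: qseq_def)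
    then have DP2: "D (P 2) = smult (2 * \<alpha>) (Q 1)" using DQ[of 1] by (simp add: numeral_2_eq_2)
    have DP1: "D (P 1) = 1" using DQ[of 0] g Q0 by simp
    have "P 1 + [:B 0:] = [:0, 1:]" using ttrr[of 0, symmetric] P0 by simp
    then have P1: "P 1 = [:0, 1:] - [:B 0:]" by (rule eq_diff_eq[THEN iffD2])
    have "Q 1 + [:b 0:] = [:0, 1:]" using Qrec[of 0, symmetric] Q0 by simp
    then have Q1: "Q 1 = [:0, 1:] - [:b 0:]" by (rule eq_diff_eq[THEN iffD2])
    have xP1: "[:0, 1:] * P 1 = [:0, 1:] * ([:0, 1:] * 1) + smult (- B 0) [:0, 1:]" unfolding P1 by simp
    have D1: "D 1 = 0" using askey_wilson_const[OF q, of 1] by (simp add: D_def one_pCons)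
    have "D ([:0, 1:] * P 1) = smult (2 * \<alpha>) [:0, 1:] - [:B 0:]"
      unfolding xP1 D_def askey_wilson_add[OF q] askey_wilson_x_x_mult[OF q \<alpha>] askey_wilson_smult[OF q]
      using D1 askey_wilson_x[OF q] by (simp add: D_def)
    moreover have "[:0, 1:] * P 1 = P 2 + smult (B 1) (P 1) + smult (C 1) 1"
      using ttrr[of 1] P0 by (simp add: numeral_2_eq_2)
    then have "D ([:0, 1:] * P 1) = D (P 2) + smult (B 1) (D (P 1))"
      using D1 by (simp only: D_def askey_wilson_add[OF q] askey_wilson_smult[OF q] smult_0_right add_0_right)
    ultimately have "smult (2 * \<alpha>) [:0, 1:] - [:B 0:] = smult (2 * \<alpha>) ([:0, 1:] - [:b 0:]) + smult (B 1) 1"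
      unfolding DP1 DP2 Q1 by simp
    from arg_cong[OF this, of "\<lambda>f. coeff f 0"] show ?thesis
      by (simp add: algebra_simps add_eq_0_iff)
  qed
  obtain l m where lm: "l \<noteq> 0 \<or> m \<noteq> 0"
    and Brec: "\<And>k. qseq l m p (2 * int k + 5) * B (k + 2)
      - (qseq l m p (2 * int k + 3) + qseq l m p (2 * int k + 1)) * B (k + 1) + qseq l m p (2 * int k - 1) * B k = 0"
    and Crec: "\<And>k. qseq l m p (2 * int k + 3) * (B (k + 2) - p^2 * B (k + 1)) * (B (k + 2) - inverse (p^2) * B (k + 1)) =
      (qseq l m p (2 * int k + 5) + qseq l m p (2 * int k + 7)) * (C (k + 3) - 1/4)
      - 4 * \<alpha>^2 * qseq l m p (2 * int k + 3) * (C (k + 2) - 1/4)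
      + (qseq l m p (2 * int k + 1) + qseq l m p (2 * int k - 1)) * (C (k + 1) - 1/4)"
  \<comment> \<open>The last two coefficients vanish only for \<open>k \<ge> 1\<close> and
    \<open>k \<ge> 2\<close>, hence the shifts by 1 and 2.\<close>
  proof (rule recurrences_from_relations[where C = C and c = c and B = B and b = b, OF p \<open>p^4 \<noteq> 1\<close> al, folded g_def])
    show "g (int k + 2) * c (k + 1) * (2 * \<alpha> * B (k + 2) - b (k + 1) - b k)
        + g (int k + 1) * C (k + 2) * (2 * \<alpha> * b k - B (k + 2) - B (k + 1)) = 0" for k
      using indep(3)[of "k + 1"] by (simp add: add_ac)
    show "2 * \<alpha> * g (int k + 2) * C (k + 3) * c (k + 1)
        - g (int k + 3) * c (k + 2) * c (k + 1) - g (int k + 1) * C (k + 3) * C (k + 2) = 0" for k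
      using indep(4)[of "k + 2"] by (simp add: add_ac numeral_3_eq_3)
  qed (use gnz C_nz c e0 indep(1,2) in auto)
  \<comment> \<open>\<open>qseq l m p (2 * int n - 1)\<close> rewritten with \<open>p^2 = q\<close>;
    the odd exponent puts the factors \<open>1 / p\<close> and \<open>p\<close> into the two
    constants.\<close>
  define r where "r = (\<lambda>n::nat. l / p * complex_of_real q ^ n + m * p * complex_of_real q powi (- int n))"
  have r: "r n = qseq l m p (2 * int n - 1)" for n
  proof -
    have "(p^2) ^ n = p ^ (2 * n)" by (rule power_mult[symmetric])
    moreover have "p powi (2 * int n) = p ^ (2 * n)" using power_int_of_nat[of p "2 * n"] by simp
    ultimately show ?thesis
      using p by (simp add: r_def qseq_def pq[symmetric] power_int_diff power_int_minus field_simps)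
  qed
  have ab: "cmod (l / p) + cmod (m * p) \<noteq> 0" using lm p by (simp add: add_nonneg_eq_0_iff)
  have rB: "r (n + 3) * B (n + 2) - (r (n + 2) + r (n + 1)) * B (n + 1) + r n * B n = 0" for n
    using Brec[of n] by (simp add: r algebra_simps)
  have rC: "r n * (B n - complex_of_real q * B (n - 1)) * (B n - inverse (complex_of_real q) * B (n - 1)) =
          (r (n + 1) + r (n + 2)) * (C (n + 1) - 1/4)
          - 4 * \<alpha>\<^sup>2 * r n * (C n - 1/4)
          + (r (n - 1) + r (n - 2)) * (C (n - 1) - 1/4)" if "2 \<le> n" for n
  proof -
    define k where "k = n - 2"
    have n: "n = k + 2" using that by (simp add: k_def)
    have i: "r (k + 2) = qseq l m p (2 * int k + 3)" "r (k + 3) = qseq l m p (2 * int k + 5)"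
      "r (k + 4) = qseq l m p (2 * int k + 7)" "r (k + 1) = qseq l m p (2 * int k + 1)" "r k = qseq l m p (2 * int k - 1)"
      by (simp_all add: r algebra_simps)
    have j: "n - 1 = k + 1" "n - 2 = k" "n + 1 = k + 3" "n + 2 = k + 4" by (simp_all add: n)
    show ?thesis
      unfolding j unfolding n i pq[symmetric] by (rule Crec)
  qed
  show ?thesis
    unfolding Let_def
    by (rule exI[of _ "l / p"], rule exI[of _ "m * p"])
      (intro conjI allI impI ab rB[unfolded r_def] rC[unfolded r_def])
qed

end
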